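(* Let $m,n$ be coprime positive integers with $m<n$. Define $i_0=n$, $i_1=m$, and recursively $i_t=(-i_{t-2}) \bmod i_{t-1}$ for $t>1$, and let $L$ be the smallest index with $i_L=1$. For $0\le t\le L$ and $j,\ell\in\mathbb{Z}$ put $$\mathcal{J}_t(j,\ell)=1-i_t+\big[(n-\ell)(\mathrm{mod}\ i_0)(\mathrm{mod}\ i_1)\cdots(\mathrm{mod}\ i_t)\big]+\big[(j-1)(\mathrm{mod}\ i_0)(\mathrm{mod}\ i_1)\cdots(\mathrm{mod}\ i_t)\big],$$ where the reductions are applied successively, first modulo $i_0$, then modulo $i_1$, and so on. For $j\in\{1,\dots,n\}$ let $\psi_j$ be the unique integer in $\{1,\dots,n\}$ with $j\equiv m\psi_j \pmod n$. Then the generalized Cremmer-Gervais $r$-matrix $r_{n-m,n}$, acting on $k^n\otimes k^n$, is given for all $j,\ell\in\{1,\dots,n\}$ by $$\begin{aligned} r_{n-m,n}(e_j\otimes e_\ell)={}&\sum_{t=0}^{L-1}\ \sum_{N=0}^{\lfloor(\mathcal{J}_t(j,\ell)-1)/i_{t+1}\rfloor}e_{j-\mathcal{J}_t(j,\ell)+Ni_{t+1}}\otimes e_{\ell+\mathcal{J}_t(j,\ell)-Ni_{t+1}}\\ &-\sum_{t=0}^{L-1}\ \sum_{N=0}^{\lfloor(\mathcal{J}_t(\ell,j)-1)/i_{t+1}\rfloor}e_{j+\mathcal{J}_t(\ell,j)-Ni_{t+1}}\otimes e_{\ell-\mathcal{J}_t(\ell,j)+Ni_{t+1}}\\ &+\Big[\tfrac12\operatorname{sgn}(\psi_j-\psi_\ell)-\tfrac1n(\psi_j-\psi_\ell)\Big]e_j\otimes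 e_\ell-\tfrac12\operatorname{sgn}(j-\ell)\,e_\ell\otimes e_j .\end{aligned}$$
   Context: $k$ is an algebraically closed field of characteristic zero. $e_1,\dots,e_n$ is the standard basis of $k^n$, and $e_{ij}$ is the elementary matrix with $e_{ij}e_\ell=\delta_{j\ell}e_i$. $a\wedge b:=\frac12(a\otimes b-b\otimes a)$; elements of $\mathfrak{sl}_n\wedge\mathfrak{sl}_n$ act on $k^n\otimes k^n$. For an integer $x$ and $p\in\mathbb{N}$, $x \bmod p$ always denotes the residue in $\{0,\dots,p-1\}$. $\operatorname{sgn}(0)=0$ and $\operatorname{sgn}(x)=x/|x|$ for $x\ne0$. A sum whose upper limit is smaller than its lower limit is empty. Definition of $r_{q,n}$ for coprime $1\le q<n$ (used in the claim with $q=n-m$): let $\alpha_1,\dots,\alpha_{n-1}$ be the simple roots of $\mathfrak{sl}_n$, $\Pi$ their set. For $a<b$ the matrix unit $e_{ab}$ is the root vector $e_\rho$ of the positive root $\rho=\alpha_a+\cdots+\alpha_{b-1}$, and $e_{-\rho}=e_{ba}$. Let $\mathcal S_0=\Pi\setminus\{\alpha_{n-q}\}$, $\mathcal S_1=\Pi\setminus\{\alpha_q\}$, and let $\zeta:\mathcal S_0\to\mathcal S_1$ be the bijection $\alpha_s\mapsto\alpha_{(s+q)\bmod n}$. Let $\widehat\zeta$ be the additive extension of $\zeta$ to the positive roots that are sums of elements of $\mathcal S_0$. For positive roots write $\rho\prec\mu$ if there is an integer $N\ge1$ such that $\widehat\zeta^{\,N}(\rho)$ is defined and equals $\mu$. Then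 $$r_{q,n}=2\sum_{\rho\prec\mu}e_\rho\wedge e_{-\mu}+\sum_{1\le j<\ell\le n}\Big(-1+\tfrac2n\big[(j-\ell)q^{-1}\bmod n\big]\Big)e_{jj}\wedge e_{\ell\ell}+\sum_{1\le j<\ell\le n}e_{j\ell}\wedge e_{\ell j},$$ where $q^{-1}$ is an inverse of $q$ modulo $n$. *)

theory Defs
  imports
    "Jordan_Normal_Form.Matrix"
    "HOL-Library.Multiset"
    "HOL-Number_Theory.Modular_Inverse"
    "HOL-Computational_Algebra.Polynomial"
begin

section \<open>Tensor products of column vectors and of matrices\<close>

text \<open>
  \<open>k^n \<otimes> k^n\<close> is realised as \<open>k^(n*n)\<close> by the Kronecker product, in the row-major order
  of the basis. The lemma \<open>kron_mat_mult_kron_vec\<close> below says that \<open>A \<otimes> B\<close> acts as it should.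
\<close>

definition kron_vec :: "'a::semiring_1 vec \<Rightarrow> 'a vec \<Rightarrow> 'a vec" (infixl "\<otimes>\<^sub>v" 72) where
  "v \<otimes>\<^sub>v w = vec (dim_vec v * dim_vec w) (\<lambda>x. v $ (x div dim_vec w) * w $ (x mod dim_vec w))"

definition kron_mat :: "'a::semiring_1 mat \<Rightarrow> 'a mat \<Rightarrow> 'a mat" (infixl "\<otimes>\<^sub>m" 72) where
  "A \<otimes>\<^sub>m B = mat (dim_row A * dim_row B) (dim_col A * dim_col B)
     (\<lambda>(x, y). A $$ (x div dim_row B, y div dim_col B) * B $$ (x mod dim_row B, y mod dim_col B))"

definition wedge_mat :: "'a::field mat \<Rightarrow> 'a mat \<Rightarrow> 'a mat" (infixl "\<and>\<^sub>m" 72) where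
  "A \<and>\<^sub>m B = (1 / 2) \<cdot>\<^sub>m (A \<otimes>\<^sub>m B - B \<otimes>\<^sub>m A)"

lemma kron_mat_mult_kron_vec:
  fixes A B :: "'a::comm_semiring_1 mat"
  assumes "A \<in> carrier_mat n n" "B \<in> carrier_mat n n" "v \<in> carrier_vec n" "w \<in> carrier_vec n"
  shows "(A \<otimes>\<^sub>m B) *\<^sub>v (v \<otimes>\<^sub>v w) = (A *\<^sub>v v) \<otimes>\<^sub>v (B *\<^sub>v w)"
proof (rule eq_vecI)
  show "dim_vec ((A \<otimes>\<^sub>m B) *\<^sub>v (v \<otimes>\<^sub>v w)) = dim_vec ((A *\<^sub>v v) \<otimes>\<^sub>v (B *\<^sub>v w))"
    using assms by (simp add: kron_mat_def kron_vec_def)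
  fix x assume "x < dim_vec ((A *\<^sub>v v) \<otimes>\<^sub>v (B *\<^sub>v w))"
  then have x: "x < n * n" using assms by (simp add: kron_vec_def)
  then have n: "n > 0" by (cases n) auto
  have xd: "x div n < n" using x n by (simp add: less_mult_imp_div_less)
  have xm: "x mod n < n" using n by simp
  have bound: "a * n + b < n * n" if "a < n" "b < n" for a b
  proof -
    have "a * n + b < Suc a * n" using that by simp
    also have "\<dots> \<le> n * n" using that by (intro mult_le_mono1) simp
    finally show ?thesis .
  qed
  have dims: "dim_row A = n" "dim_col A = n" "dim_row B = n" "dim_col B = n" "dim_vec v = n" "dim_vec w = n"
    using assms by auto
  have "((A \<otimes>\<^sub>m B) *\<^sub>v (v \<otimes>\<^sub>v w)) $ x =
      (\<Sum>y<n * n. A $$ (x div n, y div n) * B $$ (x mod n, y mod n) * (v $ (y div n) * w $ (y mod n)))"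
    using x by (simp add: kron_mat_def kron_vec_def dims scalar_prod_def lessThan_atLeast0)
  also have "\<dots> = (\<Sum>a<n. \<Sum>b<n. A $$ (x div n, a) * B $$ (x mod n, b) * (v $ a * w $ b))"
    unfolding sum.cartesian_product
    by (rule sum.reindex_bij_witness[where i = "\<lambda>(a, b). a * n + b" and j = "\<lambda>y. (y div n, y mod n)"])
       (use n bound in \<open>auto simp: less_mult_imp_div_less\<close>)
  also have "\<dots> = (\<Sum>a<n. A $$ (x div n, a) * v $ a) * (\<Sum>b<n. B $$ (x mod n, b) * w $ b)"
    by (simp add: sum_product mult_ac)
  also have "\<dots> = ((A *\<^sub>v v) \<otimes>\<^sub>v (B *\<^sub>v w)) $ x"
    using x xd xm by (simp add: kron_vec_def dims scalar_prod_def lessThan_atLeast0)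
  finally show "((A \<otimes>\<^sub>m B) *\<^sub>v (v \<otimes>\<^sub>v w)) $ x = ((A *\<^sub>v v) \<otimes>\<^sub>v (B *\<^sub>v w)) $ x" .
qed

abbreviation tensor_vecs :: "nat \<Rightarrow> ('a::semiring_1, 'a vec) module" where
  "tensor_vecs n \<equiv> module_vec TYPE('a) (n * n)"

abbreviation tensor_mats :: "nat \<Rightarrow> ('a::semiring_1, 'a mat) module" where
  "tensor_mats n \<equiv> module_mat TYPE('a) (n * n) (n * n)"

text \<open>
  Basis vectors and matrix units carry the indices \<open>1, \<dots>, n\<close>, while the library counts from \<open>0\<close>.
  The indices are integers, so that expressions like \<open>j - J + N * i\<close> do not truncate; an index
  outside \<open>{1..n}\<close> would give \<open>0\<close>, but none occurs (see \<open>cg_index_in_range\<close> below).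
\<close>

definition basis_vec :: "nat \<Rightarrow> int \<Rightarrow> 'a::semiring_1 vec" where
  "basis_vec n i = vec n (\<lambda>x. if int x + 1 = i then 1 else 0)"

definition elem_mat :: "nat \<Rightarrow> int \<Rightarrow> int \<Rightarrow> 'a::semiring_1 mat" where
  "elem_mat n i j = mat n n (\<lambda>(x, y). if int x + 1 = i \<and> int y + 1 = j then 1 else 0)"

lemma elem_mat_mult_basis_vec:
  assumes "i \<in> {1..int n}" "j \<in> {1..int n}" "l \<in> {1..int n}"
  shows "elem_mat n i j *\<^sub>v basis_vec n l = (if j = l then basis_vec n i else 0\<^sub>v n :: 'a::semiring_1 vec)"
proof (rule eq_vecI)
  fix x assume "x < dim_vec (if j = l then basis_vec n i else 0\<^sub>v n :: 'a vec)"
  then have x: "x < n" by (auto simp: basis_vec_def split: if_splits)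
  have eq: "int y + 1 = l \<longleftrightarrow> y = nat (l - 1)" for y using assms by auto
  have "(elem_mat n i j *\<^sub>v basis_vec n l :: 'a vec) $ x =
      (\<Sum>y = 0..<n. (if int x + 1 = i \<and> int y + 1 = j then 1 else 0) * (if int y + 1 = l then 1 else 0))"
    using x by (simp add: elem_mat_def basis_vec_def scalar_prod_def)
  also have "\<dots> = (\<Sum>y = 0..<n. if y = nat (l - 1) then (if int x + 1 = i \<and> j = l then 1 else 0) else 0)"
    by (rule sum.cong) (auto simp: eq[symmetric])
  also have "\<dots> = (if int x + 1 = i \<and> j = l then 1 else 0)"
    using assms by (subst sum.delta) auto
  finally show "(elem_mat n i j *\<^sub>v basis_vec n l) $ x = (if j = l then basis_vec n i else 0\<^sub>v n :: 'a vec) $ x"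
    using x by (auto simp: basis_vec_def)
qed (auto simp: elem_mat_def basis_vec_def)


section \<open>The generalized Cremmer--Gervais r-matrix\<close>

text \<open>
  The simple root \<open>\<alpha>\<^sub>s\<close> is represented by its index \<open>s\<close>, and a non-negative integral combination
  of simple roots by the multiset of its indices. Thus sums of roots are sums of multisets,
  and \<^const>\<open>image_mset\<close> is additive extension.
\<close>

definition pos_root :: "int \<Rightarrow> int \<Rightarrow> int multiset" where
  "pos_root a b = mset_set {a..<b}"

definition pos_roots :: "nat \<Rightarrow> int multiset set" where
  "pos_roots n = {pos_root a b | a b. 1 \<le> a \<and> a < b \<and> b \<le> int n}"

definition cg_S0 :: "nat \<Rightarrow> nat \<Rightarrow> int set" where
  "cg_S0 q n = {1..int n - 1} - {int n - int q}"

definition cg_zeta :: "nat \<Rightarrow> nat \<Rightarrow> int \<Rightarrow> int" where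
  "cg_zeta q n s = (s + int q) mod int n"

text \<open>The graph of the partial map \<open>\<zeta>\<close>-hat; its relational powers are the graphs of the iterates.\<close>

definition cg_zeta_hat :: "nat \<Rightarrow> nat \<Rightarrow> (int multiset \<times> int multiset) set" where
  "cg_zeta_hat q n =
     {(\<rho>, image_mset (cg_zeta q n) \<rho>) | \<rho>. \<rho> \<in> pos_roots n \<and> set_mset \<rho> \<subseteq> cg_S0 q n}"

definition cg_prec :: "nat \<Rightarrow> nat \<Rightarrow> int multiset \<Rightarrow> int multiset \<Rightarrow> bool" where
  "cg_prec q n \<rho> \<mu> \<longleftrightarrow> (\<exists>N\<ge>1. (\<rho>, \<mu>) \<in> cg_zeta_hat q n ^^ N)"

text \<open>
  A pair of positive roots \<open>\<rho> = \<alpha>\<^sub>a + \<dots> + \<alpha>\<^bsub>b-1\<^esub>\<close>, \<open>\<mu> = \<alpha>\<^sub>c + \<dots> + \<alpha>\<^bsub>d-1\<^esub>\<close>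
  is given by \<open>(a, b, c, d)\<close>; then \<open>e\<^sub>\<rho> = e\<^bsub>ab\<^esub>\<close> and \<open>e\<^bsub>-\<mu>\<^esub> = e\<^bsub>dc\<^esub>\<close>.
\<close>

definition cg_pairs :: "nat \<Rightarrow> nat \<Rightarrow> (int \<times> int \<times> int \<times> int) set" where
  "cg_pairs q n = {(a, b, c, d). 1 \<le> a \<and> a < b \<and> b \<le> int n \<and> 1 \<le> c \<and> c < d \<and> d \<le> int n \<and>
     cg_prec q n (pos_root a b) (pos_root c d)}"

definition index_pairs :: "nat \<Rightarrow> (int \<times> int) set" where
  "index_pairs n = {(j, l). 1 \<le> j \<and> j < l \<and> l \<le> int n}"

definition cg_r :: "nat \<Rightarrow> nat \<Rightarrow> 'a::field mat" where
  "cg_r q n =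
     2 \<cdot>\<^sub>m finsum (tensor_mats n) (\<lambda>(a, b, c, d). elem_mat n a b \<and>\<^sub>m elem_mat n d c) (cg_pairs q n)
     + finsum (tensor_mats n)
         (\<lambda>(j, l). (- 1 + 2 / of_nat n * of_int ((j - l) * modular_inverse (int n) (int q) mod int n))
                     \<cdot>\<^sub>m (elem_mat n j j \<and>\<^sub>m elem_mat n l l)) (index_pairs n)
     + finsum (tensor_mats n) (\<lambda>(j, l). elem_mat n j l \<and>\<^sub>m elem_mat n l j) (index_pairs n)"


section \<open>The data of the explicit formula\<close>

fun cg_i :: "nat \<Rightarrow> nat \<Rightarrow> nat \<Rightarrow> int" where
  "cg_i m n 0 = int n"
| "cg_i m n (Suc 0) = int m"
| "cg_i m n (Suc (Suc t)) = (- cg_i m n t) mod cg_i m n (Suc t)"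

definition cg_L :: "nat \<Rightarrow> nat \<Rightarrow> nat" where
  "cg_L m n = (LEAST t. cg_i m n t = 1)"

fun cg_red :: "nat \<Rightarrow> nat \<Rightarrow> nat \<Rightarrow> int \<Rightarrow> int" where
  "cg_red m n 0 x = x mod cg_i m n 0"
| "cg_red m n (Suc t) x = cg_red m n t x mod cg_i m n (Suc t)"

definition cg_J :: "nat \<Rightarrow> nat \<Rightarrow> nat \<Rightarrow> int \<Rightarrow> int \<Rightarrow> int" where
  "cg_J m n t j l = 1 - cg_i m n t + cg_red m n t (int n - l) + cg_red m n t (j - 1)"

definition cg_psi :: "nat \<Rightarrow> nat \<Rightarrow> int \<Rightarrow> int" where
  "cg_psi m n j = (THE p. p \<in> {1..int n} \<and> [j = int m * p] (mod int n))"

text \<open>\<open>L\<close> and \<open>\<psi>\<^sub>j\<close> exist, and every index in the formula lies in \<open>{1..n}\<close>.\<close>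

lemma cg_psi_ex1:
  assumes "0 < n" "coprime m n"
  shows "\<exists>!p. p \<in> {1..int n} \<and> [j = int m * p] (mod int n)"
proof -
  have co: "coprime (int m) (int n)" using assms by simp
  obtain x where x: "[int m * x = 1] (mod int n)"
    using co cong_solve_coprime_int by blast
  define p where "p = (x * j - 1) mod int n + 1"
  have "[p = x * j] (mod int n)"
    unfolding p_def cong_def by (simp add: mod_simps)
  then have "[int m * p = int m * x * j] (mod int n)"
    by (simp add: mult.assoc cong_scalar_left)
  also have "[int m * x * j = 1 * j] (mod int n)"
    using x by (rule cong_scalar_right)
  finally have "[j = int m * p] (mod int n)" by (simp add: cong_sym_eq)
  moreover have "p \<in> {1..int n}"
    using assms pos_mod_bound[of "int n" "x * j - 1"] pos_mod_sign[of "int n" "x * j - 1"]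
    unfolding p_def atLeastAtMost_iff by linarith
  moreover have "p = p'" if "p \<in> {1..int n}" "p' \<in> {1..int n}"
    "[j = int m * p] (mod int n)" "[j = int m * p'] (mod int n)" for p p'
  proof -
    have "[int m * p = int m * p'] (mod int n)" using that cong_sym cong_trans by blast
    then have "[p = p'] (mod int n)" using co cong_mult_lcancel by blast
    then have "int n dvd p - p'" by (simp add: cong_iff_dvd_diff)
    moreover have "\<bar>p - p'\<bar> < int n" using that by auto
    ultimately show "p = p'" using dvd_imp_le_int[of "p - p'" "int n"] by fastforce
  qed
  ultimately show ?thesis by blast
qed

lemma cg_i_pos_decreasing:
  assumes "0 < m" "coprime m n" "\<And>s. s \<le> t \<Longrightarrow> cg_i m n s \<noteq> 1"
  shows "coprime (cg_i m n t) (cg_i m n (Suc t)) \<and> 0 < cg_i m n (Suc t) \<and>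
    cg_i m n (Suc t) + int t \<le> int m"
  using assms(3)
proof (induction t)
  case 0
  show ?case using assms by (simp add: coprime_commute)
next
  case (Suc t)
  let ?a = "cg_i m n t" and ?b = "cg_i m n (Suc t)"
  have IH: "coprime ?a ?b" "0 < ?b" "?b + int t \<le> int m" using Suc by auto
  have b: "1 < ?b" using IH(2) Suc.prems[of "Suc t"] by simp
  have co: "coprime ?b (- ?a mod ?b)"
    using IH(1) b by (simp add: coprime_commute)
  have "- ?a mod ?b \<noteq> 0"
  proof
    assume "- ?a mod ?b = 0"
    with co b show False by simp
  qed
  moreover have "0 \<le> - ?a mod ?b" "- ?a mod ?b < ?b" using b by auto
  ultimately have "0 < - ?a mod ?b" "- ?a mod ?b + int (Suc t) \<le> int m" using IH by linarith+
  with co show ?case by simp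
qed

lemma cg_L_exists:
  assumes "0 < m" "coprime m n"
  shows "cg_i m n (cg_L m n) = 1"
proof -
  have "\<exists>t. cg_i m n t = 1"
    using cg_i_pos_decreasing[OF assms, of m] by force
  then show ?thesis unfolding cg_L_def by (rule LeastI_ex)
qed

lemma cg_i_pos:
  assumes "0 < m" "m < n" "coprime m n" "t \<le> cg_L m n"
  shows "0 < cg_i m n t"
proof (cases t)
  case 0
  then show ?thesis using assms by simp
next
  case (Suc s)
  have "cg_i m n r \<noteq> 1" if "r \<le> s" for r
    using not_less_Least[of r "\<lambda>t. cg_i m n t = 1"] that assms(4) Suc by (auto simp: cg_L_def)
  then show ?thesis using cg_i_pos_decreasing[of m n s] assms Suc by blast
qed

lemma cg_red_bounds:
  assumes "\<And>s. s \<le> t \<Longrightarrow> 0 < cg_i m n s" "0 \<le> x"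
  shows "0 \<le> cg_red m n t x \<and> cg_red m n t x \<le> x \<and> cg_red m n t x < cg_i m n t"
  using assms(1)
proof (induction t)
  case 0
  then show ?case using assms(2) 0[of 0] by (auto intro: zmod_le_nonneg_dividend)
next
  case (Suc t)
  then have IH: "0 \<le> cg_red m n t x" "cg_red m n t x \<le> x" by auto
  have "0 < cg_i m n (Suc t)" using Suc.prems by simp
  then show ?case using IH zmod_le_nonneg_dividend[OF IH(1), of "cg_i m n (Suc t)"] by auto
qed

lemma cg_index_in_range:
  assumes "0 < m" "m < n" "coprime m n" "t < cg_L m n"
    "j \<in> {1..int n}" "l \<in> {1..int n}"
    "N \<in> {0..(cg_J m n t j l - 1) div cg_i m n (t + 1)}"
  shows "j - cg_J m n t j l + N * cg_i m n (t + 1) \<in> {1..int n}"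
    "l + cg_J m n t j l - N * cg_i m n (t + 1) \<in> {1..int n}"
proof -
  let ?i = "cg_i m n (t + 1)" and ?J = "cg_J m n t j l"
  have pos: "0 < cg_i m n s" if "s \<le> t + 1" for s
    using cg_i_pos[of m n s] assms that by simp
  have i: "0 < ?i" using pos by blast
  have "cg_red m n t (int n - l) \<le> int n - l \<and> cg_red m n t (int n - l) < cg_i m n t"
    "cg_red m n t (j - 1) \<le> j - 1 \<and> cg_red m n t (j - 1) < cg_i m n t"
    using cg_red_bounds[of t m n "int n - l"] cg_red_bounds[of t m n "j - 1"] pos assms(5,6) by auto
  then have J: "?J \<le> j - 1" "?J \<le> int n - l" unfolding cg_J_def by linarith+
  have N: "0 \<le> N * ?i" using i assms(7) by simp
  have "N * ?i \<le> (?J - 1) div ?i * ?i" using i assms(7) by (simp add: mult_right_mono)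
  also have "\<dots> \<le> ?J - 1" using i pos_mod_sign[OF i, of "?J - 1"]
    unfolding minus_mod_eq_div_mult [symmetric] by linarith
  finally have "N * ?i \<le> ?J - 1" .
  with J N assms(5,6) show "j - ?J + N * ?i \<in> {1..int n}" "l + ?J - N * ?i \<in> {1..int n}"
    by auto
qed

end

theory Submission
  imports Defs
begin

text \<open>
  Applied to \<open>e\<^sub>j \<otimes> e\<^sub>l\<close>, the sum over \<open>\<rho> \<prec> \<mu>\<close> gives \<open>e\<^bsub>j-k\<^esub> \<otimes> e\<^bsub>l+k\<^esub>\<close> for every \<open>k \<ge> 1\<close> with
  \<open>\<alpha>\<^bsub>j-k\<^esub> + \<dots> + \<alpha>\<^bsub>j-1\<^esub> \<prec> \<alpha>\<^sub>l + \<dots> + \<alpha>\<^bsub>l+k-1\<^esub>\<close>, and, with opposite sign, the same with \<open>j\<close> and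
  \<open>l\<close> exchanged. So the theorem asks which lengths \<open>k\<close> occur.

  For \<open>q = n - m\<close> the map \<open>\<zeta>\<close> is a rotation by \<open>m\<close> of the residues modulo \<open>n\<close>, and its extension
  to roots of length \<open>k\<close> is undefined where the translated interval would pass the end of the
  Dynkin diagram. Followed backwards, the relation says that the orbit of \<open>n - l\<close> under
  \<open>x \<mapsto> x - m\<close> modulo \<open>n\<close> reaches \<open>n - j + k\<close> before it falls below \<open>k\<close>
  (\<open>cg_zeta_hat_iff_rot_step\<close>, \<open>hits_eq_shifts\<close>).

  This hitting problem renormalizes. Starting from \<open>A\<close>, the orbit first descends through
  \<open>A, A - m, A - 2 * m, \<dots>\<close> to \<open>A mod m\<close>, and meets the target on the way exactly for the arithmetic
  progression \<open>k = \<J>\<^sub>0 - N * m \<ge> 1\<close>. Later meetings are governed by the first return map to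
  \<open>{0..<m}\<close>, which is a rotation of the same kind for the pair \<open>(m, (- n) mod m)\<close>, with the
  start and the target reduced modulo \<open>m\<close> (\<open>hits_renormalize\<close>). The iteration runs through the pairs
  \<open>(i\<^sub>t, i\<^bsub>t+1\<^esub>)\<close>, and stage \<open>t\<close> contributes the progression \<open>\<J>\<^sub>t - N * i\<^bsub>t+1\<^esub> \<ge> 1\<close>. Coprimality makes
  the cut rotation acyclic (\<open>acyclic_rot_step\<close>), so no \<open>k\<close> is counted at two stages
  (\<open>hits_renormalize_disjoint\<close>).

  The orbit of length zero, where the two roots coincide, is counted in the explicit formula but not in
  \<open>\<prec>\<close>. It contributes \<open>sgn (j - l) e\<^sub>l \<otimes> e\<^sub>j\<close>, which the last term of the formula corrects. The
  Cartan part is a computation with residues (\<open>cartan_coefficient\<close>).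
\<close>

section \<open>Rotations of a finite cycle, cut below a threshold\<close>

text \<open>
  The rotation \<open>x \<mapsto> x - r\<close> of the residues modulo \<open>p\<close>, restricted to points not below \<open>k\<close>. For
  \<open>p = n\<close> and \<open>r = m\<close> the point \<open>x\<close> stands for the positive root of length \<open>k\<close> that starts at the
  simple root number \<open>n - x\<close>, and \<open>x \<ge> k\<close> says that this root fits into the Dynkin diagram.
\<close>

definition rot_step :: "int \<Rightarrow> int \<Rightarrow> int \<Rightarrow> (int \<times> int) set" where
  "rot_step p r k = {(x, (x - r) mod p) | x. k \<le> x \<and> x < p \<and> k \<le> (x - r) mod p}"

lemma rot_step_iff:
  "(x, y) \<in> rot_step p r k \<longleftrightarrow> y = (x - r) mod p \<and> k \<le> x \<and> x < p \<and> k \<le> y"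
  by (auto simp: rot_step_def)

text \<open>
  If \<open>s\<close> inverts \<open>r\<close> modulo \<open>p\<close>, then \<open>x * s mod p\<close> counts the steps that lead from \<open>x\<close> down
  to \<open>0\<close>. A threshold of at least \<open>1\<close> keeps the orbit away from \<open>0\<close>, so this count drops by one
  at every step.
\<close>

lemma acyclic_rot_step:
  assumes "coprime p r" "1 \<le> k"
  shows "acyclic (rot_step p r k)"
proof -
  obtain s where s: "[r * s = 1] (mod p)"
    using assms(1) cong_solve_coprime_int[of r p] by (auto simp: coprime_commute)
  have "coprime s p"
    using s by (metis cong_imp_coprime cong_sym coprime_1_left coprime_mult_left_iff)
  have "(y, x) \<in> measure (\<lambda>x. nat (x * s mod p))" if "(x, y) \<in> rot_step p r k" for x y
  proof -
    from that have y: "y = (x - r) mod p" and x: "1 \<le> x" "x < p"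
      using assms(2) by (auto simp: rot_step_iff)
    have "\<not> p dvd x" using x by (simp add: zdvd_not_zless)
    then have "\<not> p dvd x * s"
      using \<open>coprime s p\<close> by (simp add: coprime_dvd_mult_left_iff coprime_commute)
    then have "x * s mod p \<noteq> 0" by (simp add: dvd_eq_mod_eq_0)
    then have pos: "0 < x * s mod p" "x * s mod p < p"
      using x pos_mod_sign[of p "x * s"] pos_mod_bound[of p "x * s"] by linarith+
    have "y * s mod p = (x * s - r * s) mod p" by (simp add: y mod_simps algebra_simps)
    also have "\<dots> = (x * s mod p - 1) mod p"
      using s unfolding cong_def by (metis mod_diff_eq mod_diff_left_eq)
    also have "\<dots> = x * s mod p - 1" using pos by (simp add: mod_pos_pos_trivial)
    finally show ?thesis using pos by simp
  qed
  then have "rot_step p r k \<subseteq> (measure (\<lambda>x. nat (x * s mod p)))\<inverse>" by auto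
  moreover have "acyclic ((measure (\<lambda>x. nat (x * s mod p)))\<inverse>)"
    by (simp add: wf_acyclic)
  ultimately show ?thesis using acyclic_subset by blast
qed

lemma rot_step_rtrancl_bounds:
  assumes "(x, y) \<in> (rot_step p r k)\<^sup>*" "k \<le> x" "x < p" "0 \<le> k"
  shows "k \<le> y \<and> y < p"
  using assms(1)
proof (induction rule: rtrancl_induct)
  case base
  show ?case using assms by simp
next
  case (step y z)
  then show ?case using assms(4) pos_mod_bound[of p] by (auto simp: rot_step_iff)
qed

lemma rot_step_descend:
  assumes "0 < r" "0 \<le> k" "y < p" "k \<le> y - int i * r"
  shows "(y, y - int i * r) \<in> (rot_step p r k)\<^sup>*"
  using assms(4)
proof (induction i)
  case (Suc i)
  then have le: "k \<le> y - int i * r - r" by (simp add: algebra_simps)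
  then have "(y, y - int i * r) \<in> (rot_step p r k)\<^sup>*"
    using assms(1) by (intro Suc.IH) linarith
  moreover have "0 \<le> int i * r" using assms by simp
  then have "y - int i * r < p" "0 \<le> y - int i * r - r" "y - int i * r - r < p"
    using assms(1-3) le by linarith+
  then have "(y - int i * r, y - int i * r - r) \<in> rot_step p r k"
    using assms(1-3) le by (simp add: rot_step_iff mod_pos_pos_trivial)
  ultimately show ?case by (simp add: algebra_simps)
qed simp

lemma rot_step_descend_mod:
  assumes "0 < r" "0 \<le> k" "0 \<le> y" "y < p" "k \<le> y mod r"
  shows "(y, y mod r) \<in> (rot_step p r k)\<^sup>*"
proof -
  have "0 \<le> y div r" using assms by (simp add: pos_imp_zdiv_nonneg_iff)
  then have "y mod r = y - int (nat (y div r)) * r" by (simp add: minus_div_mult_eq_mod)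
  then show ?thesis using rot_step_descend[of r k y p "nat (y div r)"] assms by simp
qed

lemma rot_step_jump:
  assumes "r < p" "0 \<le> k" "k \<le> x" "x < r"
  shows "(x, x + p - r) \<in> rot_step p r k"
proof -
  have "(x - r) mod p = (x - r + p) mod p" by simp
  also have "\<dots> = x - r + p" using assms by (intro mod_pos_pos_trivial) linarith+
  finally show ?thesis using assms by (simp add: rot_step_iff algebra_simps)
qed

text \<open>
  The first return map to \<open>{0..<r}\<close> of \<open>x \<mapsto> x - r\<close> modulo \<open>p\<close> is the rotation
  \<open>x \<mapsto> x - (- p mod r)\<close> modulo \<open>r\<close>: from \<open>x < r\<close> the orbit jumps to \<open>x + p - r\<close> and then descends
  in steps of \<open>r\<close> to \<open>(x + p) mod r\<close>. The points between two returns are at least \<open>r\<close>, hence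
  above the threshold as soon as the returns are.
\<close>

lemma first_return_step:
  assumes "0 < r" "r < p" "0 \<le> k" "(x, y) \<in> rot_step r ((- p) mod r) k"
  shows "(x, y) \<in> (rot_step p r k)\<^sup>*"
proof -
  from assms have x: "k \<le> x" "x < r" "k \<le> y" "y = (x - (- p) mod r) mod r"
    by (auto simp: rot_step_iff)
  then have y: "y = (x + p - r) mod r" by (simp add: mod_simps)
  have "(x + p - r, y) \<in> (rot_step p r k)\<^sup>*"
    unfolding y using x assms y by (intro rot_step_descend_mod) auto
  with rot_step_jump[OF assms(2,3) x(1,2)] show ?thesis by (rule converse_rtrancl_into_rtrancl)
qed

lemma first_return_rtrancl:
  assumes "0 < r" "r < p" "0 \<le> k"
  shows "(rot_step r ((- p) mod r) k)\<^sup>* \<subseteq> (rot_step p r k)\<^sup>*"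
  using first_return_step[OF assms] by (intro rtrancl_subset_rtrancl) auto

text \<open>
  Conversely, every reachable point lies either on the first descent of the orbit, or on the
  descent that follows a jump from some point \<open>a\<close> of \<open>{0..<r}\<close>, and such points \<open>a\<close> are reached
  by the first return map.
\<close>

lemma rot_step_reach_cases:
  assumes "0 < r" "r < p" "0 \<le> k" "0 \<le> A" "k \<le> A" "A < p"
    and "(A, y) \<in> (rot_step p r k)\<^sup>*"
  shows "(\<exists>i\<ge>0. y = A - i * r) \<or>
    (\<exists>a i. (A mod r, a) \<in> (rot_step r ((- p) mod r) k)\<^sup>* \<and> k \<le> A mod r \<and> k \<le> a \<and> a < r \<and>
       0 \<le> i \<and> y = a + p - r - i * r)"
  using assms(7)
proof (induction rule: rtrancl_induct)
  case base
  have "A = A - 0 * r" by simp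
  then show ?case by blast
next
  case (step y z)
  from step.hyps(2) have z: "z = (y - r) mod p" "k \<le> y" "y < p" "k \<le> z"
    by (auto simp: rot_step_iff)
  show ?case
  proof (cases "r \<le> y")
    case True
    then have z': "z = y - r" using z assms by (simp add: mod_pos_pos_trivial)
    from step.IH show ?thesis
    proof (elim disjE exE conjE)
      fix i :: int assume "0 \<le> i" "y = A - i * r"
      then have "z = A - (i + 1) * r" "0 \<le> i + 1" using z' by (simp_all add: algebra_simps)
      then show ?thesis by blast
    next
      fix a i :: int
      assume "(A mod r, a) \<in> (rot_step r (- p mod r) k)\<^sup>*" "k \<le> A mod r" "k \<le> a" "a < r"
        and "0 \<le> i" "y = a + p - r - i * r"
      moreover from this have "z = a + p - r - (i + 1) * r" "0 \<le> i + 1"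
        using z' by (simp_all add: algebra_simps)
      ultimately show ?thesis by blast
    qed
  next
    case False
    then have y: "y mod r = y" using z assms by (simp add: mod_pos_pos_trivial)
    have "z = (y - r + p) mod p" using z by simp
    also have "\<dots> = y - r + p" using False z assms by (intro mod_pos_pos_trivial) linarith+
    finally have z': "z = y + p - r - 0 * r" by simp
    \<comment> \<open>\<open>y < r\<close> is the last point of its descent, hence itself a point of the first return orbit\<close>
    have "(A mod r, y) \<in> (rot_step r (- p mod r) k)\<^sup>* \<and> k \<le> A mod r"
      using step.IH
    proof (elim disjE exE conjE)
      fix i :: int assume "y = A - i * r"
      then have "A = y + i * r" by simp
      then have "A mod r = y" using y by simp
      then show ?thesis using z by simp
    next
      fix a i :: int
      assume a: "(A mod r, a) \<in> (rot_step r (- p mod r) k)\<^sup>*" "k \<le> A mod r" "k \<le> a" "a < r"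
        and "y = a + p - r - i * r"
      then have "a + p = y + (1 + i) * r" by (simp add: algebra_simps)
      then have "(a + p) mod r = y" using y by (metis mod_mult_self1)
      then have "(a - (- p mod r)) mod r = y" by (simp add: mod_simps)
      then have "(a, y) \<in> rot_step r (- p mod r) k" using a z by (simp add: rot_step_iff)
      with a show ?thesis by (meson rtrancl.rtrancl_into_rtrancl)
    qed
    then show ?thesis using z z' False by (metis linorder_not_le order.refl)
  qed
qed

section \<open>Renormalization of the hitting problem\<close>

text \<open>
  The thresholds \<open>k\<close> for which the orbit of \<open>A\<close> arrives at \<open>p - 1 - B + k\<close> without falling below
  \<open>k\<close>. The target moves with the threshold: for \<open>p = n\<close>, \<open>r = m\<close>, \<open>A = n - l\<close>, \<open>B = j - 1\<close> it is
  \<open>n - (j - k)\<close>, the point of the root \<open>\<alpha>\<^bsub>j-k\<^esub> + \<dots> + \<alpha>\<^bsub>j-1\<^esub>\<close>, while \<open>A\<close> is the point of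
  \<open>\<alpha>\<^sub>l + \<dots> + \<alpha>\<^bsub>l+k-1\<^esub>\<close>. The empty path counts, so that for \<open>l < j\<close> the length \<open>k = j - l\<close>, for
  which the two roots coincide, belongs to the set; the condition \<open>k \<le> A\<close> puts the
  starting point above the threshold also on the empty path.
\<close>

definition hits :: "int \<Rightarrow> int \<Rightarrow> int \<Rightarrow> int \<Rightarrow> int set" where
  "hits p r A B = {k. 1 \<le> k \<and> k \<le> A \<and> (A, p - 1 - B + k) \<in> (rot_step p r k)\<^sup>*}"

lemma hits_le:
  assumes "A < p" "k \<in> hits p r A B"
  shows "k \<le> A \<and> k \<le> B"
  using assms rot_step_rtrancl_bounds[of A "p - 1 - B + k" p r k] by (auto simp: hits_def)

lemma finite_hits: "finite (hits p r A B)"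
  by (rule finite_subset[of _ "{1..A}"]) (auto simp: hits_def)

text \<open>The shifts \<open>J - N * d\<close>, \<open>0 \<le> N \<le> \<lfloor>(J - 1) / d\<rfloor>\<close>, of the inner sums of the formula.\<close>

definition progression :: "int \<Rightarrow> int \<Rightarrow> int set" where
  "progression J d = {k. 1 \<le> k \<and> k \<le> J \<and> d dvd J - k}"

text \<open>
  One step of the Euclidean algorithm. The first descent \<open>A, A - r, A - 2 * r, \<dots>\<close> meets the target
  exactly when \<open>k\<close> is in the progression. A later descent starts with a jump from some \<open>a < r\<close>; there
  the target is met exactly when \<open>a = r - 1 - B mod r + k\<close>, which is the same problem for the
  first return map, with \<open>A\<close> and \<open>B\<close> reduced modulo \<open>r\<close>.
\<close>

lemma hits_renormalize:
  assumes "0 < r" "r < p" "0 \<le> A" "A < p" "0 \<le> B" "B < p"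
  shows "hits p r A B =
    progression (1 - p + A + B) r \<union> hits r ((- p) mod r) (A mod r) (B mod r)" (is "_ = ?K \<union> ?H")
proof (intro equalityI subsetI)
  fix k assume k: "k \<in> hits p r A B"
  then have k1: "1 \<le> k" "k \<le> A" and reach: "(A, p - 1 - B + k) \<in> (rot_step p r k)\<^sup>*"
    by (auto simp: hits_def)
  have kB: "k \<le> B" using hits_le[OF assms(4) k] by simp
  have "(\<exists>i\<ge>0. p - 1 - B + k = A - i * r) \<or>
    (\<exists>a i. (A mod r, a) \<in> (rot_step r ((- p) mod r) k)\<^sup>* \<and> k \<le> A mod r \<and> k \<le> a \<and> a < r \<and>
       0 \<le> i \<and> p - 1 - B + k = a + p - r - i * r)"
    using rot_step_reach_cases[OF assms(1,2) _ assms(3) k1(2) assms(4) reach] k1 by simp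
  then show "k \<in> ?K \<union> ?H"
  proof (elim disjE exE conjE)
    fix i :: int assume i: "0 \<le> i" "p - 1 - B + k = A - i * r"
    then have "1 - p + A + B - k = i * r" "0 \<le> i * r" using assms by simp_all
    then have "k \<in> ?K" using k1 unfolding progression_def
      by (metis (mono_tags, lifting) dvd_triv_right le_iff_diff_le_0 mem_Collect_eq diff_ge_0_iff_ge)
    then show ?thesis by simp
  next
    fix a i :: int
    assume a: "(A mod r, a) \<in> (rot_step r (- p mod r) k)\<^sup>*" "k \<le> A mod r" "k \<le> a" "a < r"
      and i: "0 \<le> i" "p - 1 - B + k = a + p - r - i * r"
    \<comment> \<open>the threshold \<open>a \<ge> k\<close> keeps \<open>r - 1 - (a - k)\<close> below \<open>r\<close>, so it is a residue\<close>
    have "B mod r = (r - 1 - (a - k)) mod r"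
    proof -
      have "B = r - 1 - (a - k) + i * r" using i by (simp add: algebra_simps)
      then show ?thesis by (metis mod_mult_self1)
    qed
    also have "\<dots> = r - 1 - (a - k)" using a k1 by (intro mod_pos_pos_trivial) auto
    finally have "a = r - 1 - B mod r + k" by simp
    then show ?thesis using a k1 by (auto simp: hits_def)
  qed
next
  fix k assume "k \<in> ?K \<union> ?H"
  then show "k \<in> hits p r A B"
  proof
    assume "k \<in> ?K"
    then have k: "1 \<le> k" "k \<le> 1 - p + A + B" "r dvd 1 - p + A + B - k"
      by (auto simp: progression_def)
    then obtain i where i: "1 - p + A + B - k = r * i" by (auto elim: dvdE)
    then have "0 \<le> r * i" using k by linarith
    then have "0 \<le> i" using assms(1) by (simp add: zero_le_mult_iff)
    then have C: "A - int (nat i) * r = p - 1 - B + k" using i by (simp add: algebra_simps)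
    then have "(A, p - 1 - B + k) \<in> (rot_step p r k)\<^sup>*"
      using rot_step_descend[of r k A p "nat i"] assms k by simp
    then show ?thesis using k assms by (simp add: hits_def)
  next
    assume kH: "k \<in> ?H"
    define a where "a = r - 1 - B mod r + k"
    from kH have k: "1 \<le> k" "k \<le> A mod r" and a: "(A mod r, a) \<in> (rot_step r (- p mod r) k)\<^sup>*"
      by (auto simp: hits_def a_def)
    have Am: "A mod r < r" "A mod r \<le> A" using assms by (simp_all add: zmod_le_nonneg_dividend)
    have ab: "k \<le> a" "a < r" using rot_step_rtrancl_bounds[OF a] k Am by auto
    have "(A, A mod r) \<in> (rot_step p r k)\<^sup>*"
      using assms k by (intro rot_step_descend_mod) auto
    also have "(A mod r, a) \<in> (rot_step p r k)\<^sup>*"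
      using a first_return_rtrancl[OF assms(1,2), of k] k by auto
    also have "(a, a + p - r) \<in> rot_step p r k"
      using ab k assms by (intro rot_step_jump) auto
    also have "0 \<le> B div r" using assms by (simp add: pos_imp_zdiv_nonneg_iff)
    then have C: "a + p - r - int (nat (B div r)) * r = p - 1 - B + k"
      unfolding a_def using div_mult_mod_eq[of B r] by (simp add: algebra_simps)
    have "(a + p - r, a + p - r - int (nat (B div r)) * r) \<in> (rot_step p r k)\<^sup>*"
      by (rule rot_step_descend) (use assms k ab C in auto)
    then have "(a + p - r, p - 1 - B + k) \<in> (rot_step p r k)\<^sup>*" by (simp only: C)
    finally show ?thesis using k Am by (simp add: hits_def)
  qed
qed

text \<open>
  A target met on the first descent is congruent to \<open>A\<close>; if it were met again, the first return
  orbit would lead from \<open>A mod r\<close> to \<open>a\<close> and in one further step back to \<open>A mod r\<close>,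
  contradicting acyclicity.
\<close>

lemma hits_renormalize_disjoint:
  assumes "0 < r" "r < p" "coprime p r"
  shows "progression (1 - p + A + B) r \<inter> hits r ((- p) mod r) (A mod r) (B mod r) = {}"
proof (intro equals0I)
  fix k assume "k \<in> progression (1 - p + A + B) r \<inter> hits r ((- p) mod r) (A mod r) (B mod r)"
  then have dvd: "r dvd 1 - p + A + B - k" and kH: "k \<in> hits r ((- p) mod r) (A mod r) (B mod r)"
    by (auto simp: progression_def)
  define a where "a = r - 1 - B mod r + k"
  from kH have k: "1 \<le> k" "k \<le> A mod r" and a: "(A mod r, a) \<in> (rot_step r (- p mod r) k)\<^sup>*"
    by (auto simp: hits_def a_def)
  have ab: "k \<le> a" "a < r" using rot_step_rtrancl_bounds[OF a] k assms by auto
  have "(a - (- p mod r)) mod r = (a + p) mod r" by (simp add: mod_simps)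
  also have "\<dots> = A mod r"
  proof -
    have "a + p - A = r * (1 + B div r) - (1 - p + A + B - k)"
      unfolding a_def using mult_div_mod_eq[of r B] by (simp add: algebra_simps)
    then have "r dvd a + p - A" using dvd by (metis dvd_diff dvd_triv_left)
    then show ?thesis by (simp add: mod_eq_dvd_iff)
  qed
  finally have "(a, A mod r) \<in> rot_step r (- p mod r) k"
    using ab k assms by (simp add: rot_step_iff)
  with a have "(A mod r, A mod r) \<in> (rot_step r (- p mod r) k)\<^sup>+" by (rule rtrancl_into_trancl1)
  moreover have "coprime r (- p mod r)" using assms by (simp add: coprime_commute)
  ultimately show False using acyclic_rot_step k(1) unfolding acyclic_def by blast
qed


section \<open>The order on positive roots as a cut rotation\<close>

lemma pos_root_inject:
  assumes "a < b" "c < d" "pos_root a b = pos_root c d"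
  shows "a = c" "b = d"
proof -
  have "set_mset (pos_root a b) = set_mset (pos_root c d)" using assms by simp
  then have "{a..<b} = {c..<d}" by (simp add: pos_root_def)
  then show "a = c" "b = d" using assms(1,2) by (simp_all add: atLeastLessThan_eq_iff)
qed

lemma image_zeta_pos_root:
  assumes "\<And>s. s \<in> {a..<b} \<Longrightarrow> cg_zeta q n s = s + h"
  shows "image_mset (cg_zeta q n) (pos_root a b) = pos_root (a + h) (b + h)"
proof -
  have "image_mset (cg_zeta q n) (pos_root a b) = image_mset (\<lambda>s. s + h) (pos_root a b)"
    using assms by (intro image_mset_cong) (simp add: pos_root_def)
  also have "\<dots> = mset_set ((\<lambda>s. s + h) ` {a..<b})"
    unfolding pos_root_def by (intro image_mset_mset_set) (simp add: inj_on_def)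
  also have "(\<lambda>s. s + h) ` {a..<b} = {a + h..<b + h}"
    by (rule image_add_atLeastLessThan')
  finally show ?thesis by (simp add: pos_root_def)
qed

text \<open>
  For \<open>q = n - m\<close> the map \<open>\<zeta>\<close> is \<open>s \<mapsto> s - m\<close> modulo \<open>n\<close>, so in the coordinate \<open>x = n - a\<close> of
  the first simple root it adds \<open>m\<close>: a step of \<open>\<zeta>\<close>-hat is a rotation step read backwards. The
  root \<open>\<alpha>\<^sub>a + \<dots> + \<alpha>\<^bsub>a+k-1\<^esub>\<close> avoids \<open>\<alpha>\<^sub>m\<close> if and only if its translate does not run over the end of the
  diagram, that is, if and only if the new coordinate is still at least \<open>k\<close>.
\<close>

lemma cg_zeta_hat_iff_rot_step:
  assumes "0 < m" "m < n" "1 \<le> k" "k \<le> x" "x < int n"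
  shows "(pos_root (int n - x) (int n - x + k), \<mu>) \<in> cg_zeta_hat (n - m) n \<longleftrightarrow>
    (\<exists>y. (y, x) \<in> rot_step (int n) (int m) k \<and> \<mu> = pos_root (int n - y) (int n - y + k))"
    (is "(?\<rho>, _) \<in> _ \<longleftrightarrow> _")
proof -
  define a where "a = int n - x"
  have a: "1 \<le> a" "a + k \<le> int n" using assms by (auto simp: a_def)
  have \<rho>: "?\<rho> = pos_root a (a + k)" by (simp add: a_def)
  have "pos_root a (a + k) \<in> pos_roots n" using a assms(3) unfolding pos_roots_def by force
  moreover have "set_mset (pos_root a (a + k)) \<subseteq> cg_S0 (n - m) n \<longleftrightarrow> int m \<notin> {a..<a + k}"
    using a assms by (auto simp: pos_root_def cg_S0_def of_nat_diff)
  ultimately have lhs: "(?\<rho>, \<mu>) \<in> cg_zeta_hat (n - m) n \<longleftrightarrow>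
      int m \<notin> {a..<a + k} \<and> \<mu> = image_mset (cg_zeta (n - m) n) (pos_root a (a + k))"
    unfolding \<rho> cg_zeta_hat_def by auto
  define y where "y = (x + int m) mod int n"
  have rot: "(y', x) \<in> rot_step (int n) (int m) k \<longleftrightarrow> y' = y \<and> k \<le> y" for y'
  proof
    assume "(y', x) \<in> rot_step (int n) (int m) k"
    then have "x = (y' - int m) mod int n" "k \<le> y'" "y' < int n" by (auto simp: rot_step_iff)
    moreover from this have "y = y' mod int n" by (simp add: y_def mod_simps)
    ultimately show "y' = y \<and> k \<le> y" using assms(3) by simp
  next
    assume "y' = y \<and> k \<le> y"
    moreover have "(y - int m) mod int n = x" using assms by (simp add: y_def mod_simps)
    moreover have "y < int n" using assms by (simp add: y_def)
    ultimately show "(y', x) \<in> rot_step (int n) (int m) k" using assms by (simp add: rot_step_iff)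
  qed
  consider "int m < a" | "a + k \<le> int m" | "int m \<in> {a..<a + k}" by fastforce
  then show ?thesis
  proof cases
    case 1
    then have y: "y = x + int m" using assms by (simp add: y_def a_def)
    have "cg_zeta (n - m) n s = s + - int m" if "s \<in> {a..<a + k}" for s
    proof -
      have "cg_zeta (n - m) n s = (s - int m + int n) mod int n"
        using assms by (simp add: cg_zeta_def of_nat_diff algebra_simps)
      also have "\<dots> = (s - int m) mod int n" by simp
      also have "\<dots> = s - int m" using that 1 a assms by (intro mod_pos_pos_trivial) auto
      finally show ?thesis by simp
    qed
    from image_zeta_pos_root[OF this]
    have "image_mset (cg_zeta (n - m) n) (pos_root a (a + k)) = pos_root (int n - y) (int n - y + k)"
      by (simp add: y a_def algebra_simps)
    moreover have "k \<le> y" "int m \<notin> {a..<a + k}" using y assms 1 by simp_all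
    ultimately show ?thesis unfolding lhs rot by simp
  next
    case 2
    have "y = (x + int m - int n) mod int n" by (simp add: y_def)
    also have "\<dots> = x + int m - int n"
      using 2 assms by (intro mod_pos_pos_trivial) (auto simp: a_def)
    finally have y: "y = x + int m - int n" .
    have "cg_zeta (n - m) n s = s + (int n - int m)" if "s \<in> {a..<a + k}" for s
      using that 2 a assms by (simp add: cg_zeta_def of_nat_diff)
    from image_zeta_pos_root[OF this]
    have "image_mset (cg_zeta (n - m) n) (pos_root a (a + k)) = pos_root (int n - y) (int n - y + k)"
      by (simp add: y a_def algebra_simps)
    moreover have "k \<le> y" "int m \<notin> {a..<a + k}" using y assms 2 by (simp_all add: a_def)
    ultimately show ?thesis unfolding lhs rot by simp
  next
    case 3
    have "y = (x + int m - int n) mod int n" by (simp add: y_def)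
    also have "\<dots> = x + int m - int n"
      using 3 assms by (intro mod_pos_pos_trivial) (auto simp: a_def)
    finally have "\<not> k \<le> y" using 3 by (auto simp: a_def)
    then show ?thesis unfolding lhs rot using 3 by simp
  qed
qed

lemma rot_step_trancl_fst_bounds: "(x, y) \<in> (rot_step p r k)\<^sup>+ \<Longrightarrow> k \<le> x \<and> x < p"
  by (auto dest!: tranclD simp: rot_step_iff)

lemma cg_zeta_hat_trancl_iff:
  assumes "0 < m" "m < n" "1 \<le> k" "k \<le> x" "x < int n"
  shows "(pos_root (int n - x) (int n - x + k), \<mu>) \<in> (cg_zeta_hat (n - m) n)\<^sup>+ \<longleftrightarrow>
    (\<exists>y. (y, x) \<in> (rot_step (int n) (int m) k)\<^sup>+ \<and> \<mu> = pos_root (int n - y) (int n - y + k))"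
    (is "(?\<rho> x, _) \<in> ?Z\<^sup>+ \<longleftrightarrow> ?R \<mu>")
proof
  assume "(?\<rho> x, \<mu>) \<in> ?Z\<^sup>+"
  then show "?R \<mu>"
  proof (induction rule: trancl_induct)
    case (base \<mu>)
    then show ?case using cg_zeta_hat_iff_rot_step[OF assms] by blast
  next
    case (step \<mu> \<nu>)
    then obtain y where y: "(y, x) \<in> (rot_step (int n) (int m) k)\<^sup>+" "\<mu> = ?\<rho> y" by blast
    then have "k \<le> y" "y < int n" using rot_step_trancl_fst_bounds by blast+
    with step.hyps(2) y(2) obtain z where "(z, y) \<in> rot_step (int n) (int m) k" "\<nu> = ?\<rho> z"
      using cg_zeta_hat_iff_rot_step[OF assms(1-3)] by blast
    moreover from this(1) y(1) have "(z, x) \<in> (rot_step (int n) (int m) k)\<^sup>+"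
      by (rule trancl_into_trancl2)
    ultimately show ?case by blast
  qed
next
  assume "?R \<mu>"
  then obtain y where "(y, x) \<in> (rot_step (int n) (int m) k)\<^sup>+" and \<mu>: "\<mu> = ?\<rho> y" by blast
  from this(1) have "(?\<rho> x, ?\<rho> y) \<in> ?Z\<^sup>+"
  proof (induction rule: converse_trancl_induct)
    case (base y)
    then show ?case using cg_zeta_hat_iff_rot_step[OF assms] by blast
  next
    case (step y z)
    then have "k \<le> z" "z < int n" using rot_step_trancl_fst_bounds by blast+
    then have "(?\<rho> z, ?\<rho> y) \<in> ?Z"
      using cg_zeta_hat_iff_rot_step[OF assms(1-3)] step.hyps(1) by blast
    with step.IH show ?case by (rule trancl_into_trancl)
  qed
  then show "(?\<rho> x, \<mu>) \<in> ?Z\<^sup>+" using \<mu> by simp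
qed

lemma cg_prec_iff_trancl: "cg_prec q n \<rho> \<mu> \<longleftrightarrow> (\<rho>, \<mu>) \<in> (cg_zeta_hat q n)\<^sup>+"
  unfolding cg_prec_def trancl_power by (simp add: Suc_le_eq)

lemma cg_pairs_iff:
  assumes "0 < m" "m < n"
  shows "(a, b, c, d) \<in> cg_pairs (n - m) n \<longleftrightarrow>
    (\<exists>k. 1 \<le> k \<and> b = a + k \<and> d = c + k \<and> 1 \<le> a \<and> b \<le> int n \<and> 1 \<le> c \<and> d \<le> int n \<and>
      (int n - c, int n - a) \<in> (rot_step (int n) (int m) k)\<^sup>+)" (is "_ \<longleftrightarrow> ?R")
proof -
  let ?base = "1 \<le> a \<and> a < b \<and> b \<le> int n \<and> 1 \<le> c \<and> c < d \<and> d \<le> int n"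
  let ?k = "b - a"
  have "cg_prec (n - m) n (pos_root a b) (pos_root c d) \<longleftrightarrow>
    d = c + ?k \<and> (int n - c, int n - a) \<in> (rot_step (int n) (int m) ?k)\<^sup>+" if ?base
  proof -
    have "cg_prec (n - m) n (pos_root a b) (pos_root c d) \<longleftrightarrow>
      (\<exists>y. (y, int n - a) \<in> (rot_step (int n) (int m) ?k)\<^sup>+ \<and>
        pos_root c d = pos_root (int n - y) (int n - y + ?k))"
      using cg_zeta_hat_trancl_iff[OF assms, of ?k "int n - a" "pos_root c d"] that
      by (simp add: cg_prec_iff_trancl)
    also have "\<dots> \<longleftrightarrow> d = c + ?k \<and> (int n - c, int n - a) \<in> (rot_step (int n) (int m) ?k)\<^sup>+"
    proof (intro iffI; elim exE conjE)
      fix y assume y: "(y, int n - a) \<in> (rot_step (int n) (int m) ?k)\<^sup>+"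
        "pos_root c d = pos_root (int n - y) (int n - y + ?k)"
      then have "c = int n - y" "d = int n - y + ?k" using pos_root_inject[OF _ _ y(2)] that by auto
      then have "y = int n - c" "d = c + ?k" by auto
      with y(1) show "d = c + ?k \<and> (int n - c, int n - a) \<in> (rot_step (int n) (int m) ?k)\<^sup>+" by simp
    next
      assume "d = c + ?k" "(int n - c, int n - a) \<in> (rot_step (int n) (int m) ?k)\<^sup>+"
      then show "\<exists>y. (y, int n - a) \<in> (rot_step (int n) (int m) ?k)\<^sup>+ \<and>
        pos_root c d = pos_root (int n - y) (int n - y + ?k)"
        by (intro exI[of _ "int n - c"]) simp
    qed
    finally show ?thesis .
  qed
  then have "(a, b, c, d) \<in> cg_pairs (n - m) n \<longleftrightarrow> ?base \<and> d = c + ?k \<and>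
      (int n - c, int n - a) \<in> (rot_step (int n) (int m) ?k)\<^sup>+"
    unfolding cg_pairs_def by auto
  also have "\<dots> \<longleftrightarrow> ?R" by (auto intro!: exI[of _ ?k])
  finally show ?thesis .
qed

text \<open>
  Roots related by \<open>\<prec>\<close> have equal length, so a term \<open>e\<^sub>\<rho> \<otimes> e\<^bsub>-\<mu>\<^esub>\<close> that does not annihilate
  \<open>e\<^sub>j \<otimes> e\<^sub>l\<close> sends it to some \<open>e\<^bsub>j-k\<^esub> \<otimes> e\<^bsub>l+k\<^esub>\<close>; these are the \<open>k\<close> that occur. The other halves of the
  wedges give the same with \<open>j\<close> and \<open>l\<close> exchanged.
\<close>

definition shifts :: "nat \<Rightarrow> nat \<Rightarrow> int \<Rightarrow> int \<Rightarrow> int set" where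
  "shifts m n j l = {k. (j - k, j, l, l + k) \<in> cg_pairs (n - m) n}"

text \<open>
  Paths of positive length are the pairs \<open>\<rho> \<prec> \<mu>\<close>. The empty path contributes \<open>k = j - l\<close>, and
  acyclicity excludes this value from the other paths.
\<close>

lemma hits_eq_shifts:
  assumes "0 < m" "m < n" "coprime m n" "j \<in> {1..int n}" "l \<in> {1..int n}"
  shows "hits (int n) (int m) (int n - l) (j - 1) = shifts m n j l \<union> (if l < j then {j - l} else {})"
    and "j - l \<notin> shifts m n j l"
proof -
  have S: "k \<in> shifts m n j l \<longleftrightarrow> 1 \<le> k \<and> k \<le> j - 1 \<and> k \<le> int n - l \<and>
    (int n - l, int n - j + k) \<in> (rot_step (int n) (int m) k)\<^sup>+" for k
    using assms(4,5) unfolding shifts_def by (auto simp: cg_pairs_iff[OF assms(1,2)] algebra_simps)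
  have H: "k \<in> hits (int n) (int m) (int n - l) (j - 1) \<longleftrightarrow> 1 \<le> k \<and> k \<le> j - 1 \<and> k \<le> int n - l \<and>
    (int n - l, int n - j + k) \<in> (rot_step (int n) (int m) k)\<^sup>*" for k
    using hits_le[of "int n - l" "int n" k "int m" "j - 1"] assms(4,5)
    by (auto simp: hits_def algebra_simps)
  show "hits (int n) (int m) (int n - l) (j - 1) = shifts m n j l \<union> (if l < j then {j - l} else {})"
    using assms(4,5) by (auto simp: S H rtrancl_eq_or_trancl)
  have "acyclic (rot_step (int n) (int m) (j - l))" if "1 \<le> j - l"
    using assms(3) that by (intro acyclic_rot_step) (simp_all add: coprime_commute)
  then show "j - l \<notin> shifts m n j l" by (auto simp: S acyclic_def)
qed

section \<open>Summation along the Euclidean algorithm\<close>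

lemma sum_progression:
  fixes f :: "int \<Rightarrow> 'b::comm_monoid_add"
  assumes "0 < d"
  shows "(\<Sum>k\<in>progression J d. f k) = (\<Sum>N\<in>{0..(J - 1) div d}. f (J - N * d))"
proof (rule sum.reindex_bij_witness[where i = "\<lambda>N. J - N * d" and j = "\<lambda>k. (J - k) div d"])
  fix k assume k: "k \<in> progression J d"
  then show "J - (J - k) div d * d = k" "f (J - (J - k) div d * d) = f k"
    by (simp_all add: progression_def)
  show "(J - k) div d \<in> {0..(J - 1) div d}"
    using k assms by (auto simp: progression_def pos_imp_zdiv_nonneg_iff intro: zdiv_mono1)
next
  fix N assume N: "N \<in> {0..(J - 1) div d}"
  show "(J - (J - N * d)) div d = N" using assms by simp
  have "N * d \<le> (J - 1) div d * d" using N assms by (simp add: mult_right_mono)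
  also have "\<dots> \<le> J - 1" using assms by (metis div_mod_decomp_int le_add_same_cancel1 pos_mod_sign)
  finally show "J - N * d \<in> progression J d" using N assms by (simp add: progression_def)
qed

text \<open>
  The pairs \<open>(i\<^sub>t, i\<^bsub>t+1\<^esub>)\<close> and the successive reductions are those produced by iterating
  \<open>hits_renormalize\<close>, whose progression at stage \<open>t\<close> has the top term \<open>\<J>\<^sub>t\<close>.
\<close>

lemma sum_hits_telescope:
  fixes f :: "int \<Rightarrow> 'b::comm_monoid_add"
  assumes "0 < m" "m < n" "coprime m n" "0 \<le> A" "A < int n" "0 \<le> B" "B < int n" "T \<le> cg_L m n"
  shows "(\<Sum>k\<in>hits (int n) (int m) A B. f k) =
    (\<Sum>t<T. \<Sum>k\<in>progression (1 - cg_i m n t + cg_red m n t A + cg_red m n t B) (cg_i m n (Suc t)). f k)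
    + (\<Sum>k\<in>hits (cg_i m n T) (cg_i m n (Suc T)) (cg_red m n T A) (cg_red m n T B). f k)"
  using assms(8)
proof (induction T)
  case 0
  then show ?case using assms by simp
next
  case (Suc T)
  let ?p = "cg_i m n T" and ?r = "cg_i m n (Suc T)"
  let ?A = "cg_red m n T A" and ?B = "cg_red m n T B"
  have ne1: "cg_i m n s \<noteq> 1" if "s \<le> T" for s
    using not_less_Least[of s "\<lambda>t. cg_i m n t = 1"] that Suc.prems by (auto simp: cg_L_def)
  then have co: "coprime ?p ?r" and r: "0 < ?r"
    using cg_i_pos_decreasing[of m n T] assms by auto
  have pos: "0 < cg_i m n s" if "s \<le> T" for s using cg_i_pos[of m n s] assms that Suc.prems by simp
  have "?r < ?p"
  proof (cases T)
    case (Suc T')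
    then show ?thesis using pos[of T] by simp
  qed (use assms in simp)
  note bounds = cg_red_bounds[of T m n A, OF pos assms(4)] cg_red_bounds[of T m n B, OF pos assms(6)]
  have "hits ?p ?r ?A ?B = progression (1 - ?p + ?A + ?B) ?r \<union>
      hits ?r (cg_i m n (Suc (Suc T))) (cg_red m n (Suc T) A) (cg_red m n (Suc T) B)"
    using hits_renormalize[of ?r ?p ?A ?B] r \<open>?r < ?p\<close> bounds by simp
  moreover have "progression (1 - ?p + ?A + ?B) ?r \<inter>
      hits ?r (cg_i m n (Suc (Suc T))) (cg_red m n (Suc T) A) (cg_red m n (Suc T) B) = {}"
    using hits_renormalize_disjoint[OF r \<open>?r < ?p\<close> co, of ?A ?B] by simp
  moreover have "finite (hits ?p ?r ?A ?B)" by (rule finite_hits)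
  ultimately have "(\<Sum>k\<in>hits ?p ?r ?A ?B. f k) = (\<Sum>k\<in>progression (1 - ?p + ?A + ?B) ?r. f k) +
      (\<Sum>k\<in>hits ?r (cg_i m n (Suc (Suc T))) (cg_red m n (Suc T) A) (cg_red m n (Suc T) B). f k)"
    by (metis finite_Un sum.union_disjoint)
  then show ?case using Suc.IH Suc.prems by (simp add: add.assoc del: cg_i.simps cg_red.simps)
qed

text \<open>At stage \<open>L\<close> the modulus is \<open>1\<close>, so the remainder of \<open>A\<close> is \<open>0\<close> and no threshold is left.\<close>

lemma sum_hits:
  fixes f :: "int \<Rightarrow> 'b::comm_monoid_add"
  assumes "0 < m" "m < n" "coprime m n" "j \<in> {1..int n}" "l \<in> {1..int n}"
  shows "(\<Sum>k\<in>hits (int n) (int m) (int n - l) (j - 1). f k) =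
    (\<Sum>t\<in>{0..<cg_L m n}. \<Sum>N\<in>{0..(cg_J m n t j l - 1) div cg_i m n (t + 1)}.
       f (cg_J m n t j l - N * cg_i m n (t + 1)))"
proof -
  let ?L = "cg_L m n" and ?A = "int n - l"
  have "cg_red m n ?L ?A < cg_i m n ?L"
    using cg_red_bounds[of ?L m n ?A] cg_i_pos[of m n] assms by auto
  then have "cg_red m n ?L ?A \<le> 0" using cg_L_exists[of m n] assms by simp
  then have "hits (cg_i m n ?L) (cg_i m n (Suc ?L)) (cg_red m n ?L ?A) (cg_red m n ?L (j - 1)) = {}"
    by (auto simp: hits_def)
  then have "(\<Sum>k\<in>hits (int n) (int m) ?A (j - 1). f k) =
    (\<Sum>t<?L. \<Sum>k\<in>progression (cg_J m n t j l) (cg_i m n (Suc t)). f k)"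
    using sum_hits_telescope[of m n ?A "j - 1" ?L f] assms by (simp add: cg_J_def)
  also have "\<dots> = (\<Sum>t<?L. \<Sum>N\<in>{0..(cg_J m n t j l - 1) div cg_i m n (Suc t)}.
       f (cg_J m n t j l - N * cg_i m n (Suc t)))"
    using assms by (intro sum.cong refl sum_progression cg_i_pos) auto
  finally show ?thesis by (simp add: lessThan_atLeast0)
qed

text \<open>
  The summand with \<open>k = j - l\<close> in the explicit formula is the empty path; it is no part of the
  sum over \<open>\<prec>\<close>.
\<close>

lemma sum_shifts:
  fixes f :: "int \<Rightarrow> 'b::ab_group_add"
  assumes "0 < m" "m < n" "coprime m n" "j \<in> {1..int n}" "l \<in> {1..int n}"
  shows "(\<Sum>k\<in>shifts m n j l. f k) =
    (\<Sum>t\<in>{0..<cg_L m n}. \<Sum>N\<in>{0..(cg_J m n t j l - 1) div cg_i m n (t + 1)}.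
       f (cg_J m n t j l - N * cg_i m n (t + 1))) - (if l < j then f (j - l) else 0)"
proof -
  have "finite (shifts m n j l)"
    using finite_hits[of "int n" "int m" "int n - l" "j - 1"] unfolding hits_eq_shifts(1)[OF assms] by simp
  then have "(\<Sum>k\<in>hits (int n) (int m) (int n - l) (j - 1). f k) =
      (\<Sum>k\<in>shifts m n j l. f k) + (if l < j then f (j - l) else 0)"
    unfolding hits_eq_shifts(1)[OF assms] using hits_eq_shifts(2)[OF assms] by (simp add: add.commute)
  then show ?thesis unfolding sum_hits[OF assms] by (simp add: eq_diff_eq)
qed

section \<open>Components of the action on the tensor square\<close>

lemma abelian_monoid_module_vec: "abelian_monoid (module_vec TYPE('a::semiring_1) N)"
  by (rule abelian_monoidI) (auto simp: module_vec_simps intro: comm_add_vec)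

lemma finsum_module_vec_closed:
  assumes "\<And>s. s \<in> S \<Longrightarrow> (f s :: 'a::semiring_1 vec) \<in> carrier_vec N"
  shows "finsum (module_vec TYPE('a) N) f S \<in> carrier_vec N"
  using abelian_monoid.finsum_closed[OF abelian_monoid_module_vec[where 'a = 'a], of f S N] assms
  by (auto simp: module_vec_simps)

lemma index_finsum_module_vec:
  assumes "finite S" "\<And>s. s \<in> S \<Longrightarrow> (f s :: 'a::semiring_1 vec) \<in> carrier_vec N" "x < N"
  shows "finsum (module_vec TYPE('a) N) f S $ x = (\<Sum>s\<in>S. f s $ x)"
  using assms(1,2)
proof (induction S rule: finite_induct)
  case empty
  then show ?case using assms(3)
    by (simp add: abelian_monoid.finsum_empty[OF abelian_monoid_module_vec] module_vec_simps)
next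
  case (insert s S)
  have "finsum (module_vec TYPE('a) N) f (insert s S) = f s + finsum (module_vec TYPE('a) N) f S"
    using abelian_monoid.finsum_insert[OF abelian_monoid_module_vec[where 'a = 'a], of S s f N] insert
    by (auto simp: module_vec_simps)
  moreover have "finsum (module_vec TYPE('a) N) f S \<in> carrier_vec N"
    using insert by (intro finsum_module_vec_closed) auto
  ultimately show ?case using insert assms(3) by simp
qed

lemma finsum_module_mat_closed:
  assumes "\<And>s. s \<in> S \<Longrightarrow> (M s :: 'a::comm_ring_1 mat) \<in> carrier_mat p q"
  shows "finsum (module_mat TYPE('a) p q) M S \<in> carrier_mat p q"
  using abelian_monoid.finsum_closed[OF abelian_group.axioms(1)[OF abelian_group_mat[where 'a = 'a]], of M S p q]
    assms by (auto simp: module_mat_simps)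

lemma index_finsum_mult_mat_vec:
  assumes "finite S" "\<And>s. s \<in> S \<Longrightarrow> (M s :: 'a::comm_ring_1 mat) \<in> carrier_mat p q"
    and "v \<in> carrier_vec q" "x < p"
  shows "(finsum (module_mat TYPE('a) p q) M S *\<^sub>v v) $ x = (\<Sum>s\<in>S. (M s *\<^sub>v v) $ x)"
  using assms(1,2)
proof (induction S rule: finite_induct)
  case empty
  then show ?case using assms(3,4)
    by (simp add: abelian_monoid.finsum_empty[OF abelian_group.axioms(1)[OF abelian_group_mat]] module_mat_simps)
next
  case (insert s S)
  have "finsum (module_mat TYPE('a) p q) M (insert s S) = M s + finsum (module_mat TYPE('a) p q) M S"
    using abelian_monoid.finsum_insert
        [OF abelian_group.axioms(1)[OF abelian_group_mat[where 'a = 'a]], of S s M p q] insert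
    by (auto simp: module_mat_simps)
  moreover have F: "finsum (module_mat TYPE('a) p q) M S \<in> carrier_mat p q"
    using insert by (intro finsum_module_mat_closed) auto
  moreover have "M s \<in> carrier_mat p q" using insert by simp
  ultimately have "finsum (module_mat TYPE('a) p q) M (insert s S) *\<^sub>v v =
      M s *\<^sub>v v + finsum (module_mat TYPE('a) p q) M S *\<^sub>v v"
    using assms(3) by (simp add: add_mult_distrib_mat_vec)
  then show ?case using insert F assms(4) by simp
qed

lemma index_smult_mat_mult_vec:
  assumes "(A :: 'a::comm_ring_1 mat) \<in> carrier_mat p q" "v \<in> carrier_vec q" "x < p"
  shows "((c \<cdot>\<^sub>m A) *\<^sub>v v) $ x = c * (A *\<^sub>v v) $ x"
  using assms by (simp add: scalar_prod_def sum_distrib_left mult.assoc)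

lemma index_finsum_finsum_module_vec:
  assumes "finite S" "\<And>s. s \<in> S \<Longrightarrow> finite (U s)"
    and "\<And>s u. (f s u :: 'a::semiring_1 vec) \<in> carrier_vec N" "x < N"
  shows "finsum (module_vec TYPE('a) N) (\<lambda>s. finsum (module_vec TYPE('a) N) (f s) (U s)) S $ x =
    (\<Sum>s\<in>S. \<Sum>u\<in>U s. f s u $ x)"
  using assms by (simp add: index_finsum_module_vec finsum_module_vec_closed)

lemma kron_vec_carrier: "v \<in> carrier_vec p \<Longrightarrow> w \<in> carrier_vec q \<Longrightarrow> v \<otimes>\<^sub>v w \<in> carrier_vec (p * q)"
  by (auto simp: kron_vec_def)

lemma wedge_mat_carrier:
  "A \<in> carrier_mat n n \<Longrightarrow> B \<in> carrier_mat n n \<Longrightarrow> A \<and>\<^sub>m B \<in> carrier_mat (n * n) (n * n)"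
  by (auto simp: wedge_mat_def kron_mat_def)

lemma elem_mat_carrier: "elem_mat n i j \<in> carrier_mat n n"
  by (simp add: elem_mat_def)

lemma basis_vec_carrier: "basis_vec n i \<in> carrier_vec n"
  by (simp add: basis_vec_def)

lemma wedge_mult_basis:
  fixes n x :: nat
  defines "E \<equiv> \<lambda>a b. (basis_vec n a \<otimes>\<^sub>v basis_vec n b :: 'a::field vec) $ x"
  assumes "{a, b, c, d, j, l} \<subseteq> {1..int n}" "x < n * n"
  shows "((elem_mat n a b \<and>\<^sub>m elem_mat n c d :: 'a mat) *\<^sub>v (basis_vec n j \<otimes>\<^sub>v basis_vec n l)) $ x =
    1 / 2 * ((if b = j \<and> d = l then E a c else 0) - (if d = j \<and> b = l then E c a else 0))"
proof -
  let ?v = "basis_vec n j \<otimes>\<^sub>v basis_vec n l :: 'a vec"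
  have v: "?v \<in> carrier_vec (n * n)" by (intro kron_vec_carrier basis_vec_carrier)
  have kron: "((elem_mat n a b \<otimes>\<^sub>m elem_mat n c d) *\<^sub>v ?v) $ x = (if b = j \<and> d = l then E a c else 0)"
    if "{a, b, c, d} \<subseteq> {1..int n}" for a b c d
  proof -
    have "n > 0" using assms(3) by (cases n) auto
    then have "x div n < n" "x mod n < n" using assms(3) by (simp_all add: less_mult_imp_div_less)
    have "(elem_mat n a b \<otimes>\<^sub>m elem_mat n c d) *\<^sub>v ?v =
        (if b = j then basis_vec n a else 0\<^sub>v n) \<otimes>\<^sub>v (if d = l then basis_vec n c else 0\<^sub>v n)"
      using that assms(2)
      by (simp add: kron_mat_mult_kron_vec[OF elem_mat_carrier elem_mat_carrier basis_vec_carrier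
            basis_vec_carrier] elem_mat_mult_basis_vec)
    also have "\<dots> $ x = (if b = j \<and> d = l then E a c else 0)"
      using assms(3) \<open>x div n < n\<close> \<open>x mod n < n\<close>
      by (auto simp: E_def kron_vec_def basis_vec_def)
    finally show ?thesis .
  qed
  have K: "(elem_mat n a b \<otimes>\<^sub>m elem_mat n c d :: 'a mat) \<in> carrier_mat (n * n) (n * n)" for a b c d
    by (simp add: kron_mat_def elem_mat_def)
  let ?A = "elem_mat n a b \<otimes>\<^sub>m elem_mat n c d :: 'a mat"
  let ?B = "elem_mat n c d \<otimes>\<^sub>m elem_mat n a b :: 'a mat"
  have "((elem_mat n a b \<and>\<^sub>m elem_mat n c d) *\<^sub>v ?v) $ x = 1 / 2 * ((?A - ?B) *\<^sub>v ?v) $ x"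
    unfolding wedge_mat_def
    by (rule index_smult_mat_mult_vec[OF minus_carrier_mat v assms(3)]) (rule K)
  also have "(?A - ?B) *\<^sub>v ?v = ?A *\<^sub>v ?v - ?B *\<^sub>v ?v"
    by (rule minus_mult_distrib_mat_vec[OF K K v])
  also have "(?A *\<^sub>v ?v - ?B *\<^sub>v ?v) $ x = (?A *\<^sub>v ?v) $ x - (?B *\<^sub>v ?v) $ x"
    using assms(3) K[of c d a b] by (simp del: index_mult_mat_vec)
  finally show ?thesis using assms(2) by (simp add: kron)
qed

lemma finite_cg_pairs: "finite (cg_pairs q n)"
  by (rule finite_subset[of _ "{1..int n} \<times> {1..int n} \<times> {1..int n} \<times> {1..int n}"])
    (auto simp: cg_pairs_def)

lemma finite_index_pairs: "finite (index_pairs n)"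
  by (rule finite_subset[of _ "{1..int n} \<times> {1..int n}"]) (auto simp: index_pairs_def)

lemma sum_cg_pairs:
  fixes f :: "int \<Rightarrow> int \<Rightarrow> 'b::comm_monoid_add"
  assumes "0 < m" "m < n"
  shows "(\<Sum>(a, b, c, d)\<in>cg_pairs (n - m) n. if b = j \<and> c = l then f a d else 0) =
    (\<Sum>k\<in>shifts m n j l. f (j - k) (l + k))"
proof -
  have "(\<Sum>(a, b, c, d)\<in>cg_pairs (n - m) n. if b = j \<and> c = l then f a d else 0) =
    (\<Sum>(a, b, c, d)\<in>{(a, b, c, d) \<in> cg_pairs (n - m) n. b = j \<and> c = l}. f a d)"
    by (rule sum.mono_neutral_cong_right) (auto simp: finite_cg_pairs split: if_splits)
  also have "\<dots> = (\<Sum>k\<in>shifts m n j l. f (j - k) (l + k))"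
    by (rule sum.reindex_bij_witness[where i = "\<lambda>k. (j - k, j, l, l + k)" and j = "\<lambda>(a, b, c, d). b - a"])
      (auto simp: shifts_def cg_pairs_iff[OF assms])
  finally show ?thesis .
qed

lemma sum_index_pairs:
  fixes f :: "int \<Rightarrow> int \<Rightarrow> 'b::comm_monoid_add"
  assumes "j \<in> {1..int n}" "l \<in> {1..int n}"
  shows "(\<Sum>(a, b)\<in>index_pairs n. if a = j \<and> b = l then f a b else 0) = (if j < l then f j l else 0)"
proof -
  have "(\<Sum>(a, b)\<in>index_pairs n. if a = j \<and> b = l then f a b else 0) =
    (\<Sum>s\<in>index_pairs n. if s = (j, l) then f j l else 0)"
    by (intro sum.cong) (auto split: if_splits)
  then show ?thesis using assms by (simp add: sum.delta finite_index_pairs) (auto simp: index_pairs_def)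
qed

lemma cg_psi_props:
  assumes "0 < n" "coprime m n"
  shows "cg_psi m n j \<in> {1..int n}" "[j = int m * cg_psi m n j] (mod int n)"
  using theI'[OF cg_psi_ex1[OF assms, of j]] by (simp_all add: cg_psi_def)

text \<open>
  Since \<open>q \<equiv> - m\<close> and \<open>j - l \<equiv> m * (\<psi>\<^sub>j - \<psi>\<^sub>l)\<close>, the residue in the Cartan part is that of
  \<open>\<psi>\<^sub>l - \<psi>\<^sub>j\<close>: this number itself or its sum with \<open>n\<close>, according to its sign. The two cases give
  the sign function.
\<close>

lemma cartan_coefficient:
  assumes "0 < m" "m < n" "coprime m n" "j \<in> {1..int n}" "l \<in> {1..int n}" "j \<noteq> l"
  shows "(1 / 2 * (- 1 + 2 / of_nat n *
      of_int ((j - l) * modular_inverse (int n) (int (n - m)) mod int n)) :: 'a::field_char_0) =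
    1 / 2 * of_int (sgn (cg_psi m n j - cg_psi m n l)) - 1 / of_nat n * of_int (cg_psi m n j - cg_psi m n l)"
proof -
  let ?q = "int (n - m)" and ?j = "cg_psi m n j" and ?l = "cg_psi m n l"
  let ?s = "modular_inverse (int n) ?q"
  have q: "?q = int n - int m" using assms by simp
  have "coprime ?q (int n)"
    using assms(3) unfolding q
    by (metis coprime_int_iff coprime_commute coprime_diff_one_left_nat gcd_diff1 coprime_iff_gcd_eq_1 gcd.commute minus_diff_eq gcd_neg1_int)
  then have s: "[?q * ?s = 1] (mod int n)" using assms by (intro cong_modular_inverse1) auto
  have psi: "?j \<in> {1..int n}" "?l \<in> {1..int n}"
    "[j = int m * ?j] (mod int n)" "[l = int m * ?l] (mod int n)"
    using cg_psi_props[of n m] assms by auto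
  have "[(j - l) * ?s = (int m * ?j - int m * ?l) * ?s] (mod int n)"
    using psi by (intro cong_mult cong_diff cong_refl)
  also have "(int m * ?j - int m * ?l) * ?s = ?q * ?s * (?l - ?j) + int n * ((?j - ?l) * ?s)"
    by (simp add: q algebra_simps)
  also have "[\<dots> = 1 * (?l - ?j) + 0] (mod int n)"
    using s by (intro cong_add cong_scalar_right) (simp_all add: cong_0_iff)
  finally have val: "(j - l) * ?s mod int n = (?l - ?j) mod int n" by (simp add: cong_def)
  have "?j \<noteq> ?l"
  proof
    assume "?j = ?l"
    with psi have "[j = l] (mod int n)" by (metis cong_sym cong_trans)
    then have "int n dvd j - l" by (simp add: cong_iff_dvd_diff)
    moreover have "\<bar>j - l\<bar> < int n" using assms by auto
    ultimately show False using dvd_imp_le_int[of "j - l" "int n"] assms(6) by fastforce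
  qed
  then consider "?j < ?l" | "?l < ?j" by linarith
  then show ?thesis
  proof cases
    case 1
    then have "(?l - ?j) mod int n = ?l - ?j" using psi by (intro mod_pos_pos_trivial) auto
    with val have mod: "(j - l) * ?s mod int n = ?l - ?j" by (rule trans)
    show ?thesis unfolding mod using 1 assms by (simp add: field_simps)
  next
    case 2
    have "(?l - ?j) mod int n = (?l - ?j + int n) mod int n" by simp
    also have "\<dots> = ?l - ?j + int n" using 2 psi by (intro mod_pos_pos_trivial) auto
    finally have mod: "(j - l) * ?s mod int n = ?l - ?j + int n" using val by (rule trans[rotated])
    show ?thesis unfolding mod using 2 assms by (simp add: field_simps)
  qed
qed

lemma sum_wedge_components:
  "(\<Sum>s\<in>S. 1 / 2 * (f s - g s)) = (1 / 2 * (sum f S - sum g S) :: 'a::field)"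
  by (simp only: sum_subtractf flip: sum_distrib_left)

lemma mult_half_if_diff:
  "u * (1 / 2 * ((if P then y else 0) - (if Q then z else 0))) =
    (1 / 2 * ((if P then u * y else 0) - (if Q then u * z else 0)) :: 'a::field)"
  by (cases P; cases Q) (simp_all add: right_diff_distrib)

text \<open>
  In each of the three sums of the r-matrix, only the terms whose two column indices are \<open>j\<close> and
  \<open>l\<close> act non-trivially, and the two halves of the wedge select the two orders. The factor
  \<open>1/2\<close> of the wedge is cancelled in the sum over roots only.
\<close>

lemma cg_r_action:
  fixes m n x :: nat
  defines "E \<equiv> \<lambda>a b. (basis_vec n a \<otimes>\<^sub>v basis_vec n b :: 'a::field_char_0 vec) $ x"
  assumes "0 < m" "m < n" "coprime m n" "j \<in> {1..int n}" "l \<in> {1..int n}" "x < n * n"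
  shows "((cg_r (n - m) n :: 'a mat) *\<^sub>v (basis_vec n j \<otimes>\<^sub>v basis_vec n l)) $ x =
    (\<Sum>k\<in>shifts m n j l. E (j - k) (l + k)) - (\<Sum>k\<in>shifts m n l j. E (j + k) (l - k))
    + (1 / 2 * of_int (sgn (cg_psi m n j - cg_psi m n l))
        - 1 / of_nat n * of_int (cg_psi m n j - cg_psi m n l)) * E j l
    + 1 / 2 * of_int (sgn (j - l)) * E l j"
proof -
  let ?v = "basis_vec n j \<otimes>\<^sub>v basis_vec n l :: 'a vec"
  define c where "c = (\<lambda>j l. (- 1 + 2 / of_nat n *
      of_int ((j - l) * modular_inverse (int n) (int (n - m)) mod int n)) :: 'a)"
  define M1 where "M1 = (\<lambda>(a, b, c, d). elem_mat n a b \<and>\<^sub>m elem_mat n d c :: 'a mat)"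
  define M2 where "M2 = (\<lambda>(j, l). c j l \<cdot>\<^sub>m (elem_mat n j j \<and>\<^sub>m elem_mat n l l) :: 'a mat)"
  define M3 where "M3 = (\<lambda>(j, l). elem_mat n j l \<and>\<^sub>m elem_mat n l j :: 'a mat)"
  let ?F1 = "finsum (tensor_mats n) M1 (cg_pairs (n - m) n)"
  let ?F2 = "finsum (tensor_mats n) M2 (index_pairs n)"
  let ?F3 = "finsum (tensor_mats n) M3 (index_pairs n)"
  have v: "?v \<in> carrier_vec (n * n)" by (intro kron_vec_carrier basis_vec_carrier)
  have W: "(elem_mat n a b \<and>\<^sub>m elem_mat n c d :: 'a mat) \<in> carrier_mat (n * n) (n * n)" for a b c d
    by (intro wedge_mat_carrier elem_mat_carrier)
  have M: "M1 s \<in> carrier_mat (n * n) (n * n)" "M2 s' \<in> carrier_mat (n * n) (n * n)"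
    "M3 s' \<in> carrier_mat (n * n) (n * n)" for s s'
    by (auto simp: M1_def M2_def M3_def W split: prod.split)
  have F: "?F1 \<in> carrier_mat (n * n) (n * n)" "?F2 \<in> carrier_mat (n * n) (n * n)"
    "?F3 \<in> carrier_mat (n * n) (n * n)"
    by (intro finsum_module_mat_closed M)+
  have r: "cg_r (n - m) n = 2 \<cdot>\<^sub>m ?F1 + ?F2 + ?F3"
    unfolding cg_r_def M1_def M2_def M3_def c_def ..
  have "cg_r (n - m) n *\<^sub>v ?v = (2 \<cdot>\<^sub>m ?F1) *\<^sub>v ?v + ?F2 *\<^sub>v ?v + ?F3 *\<^sub>v ?v"
    using F v by (simp add: r add_mult_distrib_mat_vec[where nr = "n * n" and nc = "n * n"])
  then have split: "(cg_r (n - m) n *\<^sub>v ?v) $ x = 2 * (?F1 *\<^sub>v ?v) $ x + (?F2 *\<^sub>v ?v) $ x + (?F3 *\<^sub>v ?v) $ x"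
    using F assms(7) index_smult_mat_mult_vec[OF F(1) v assms(7), of 2]
    by (simp del: index_mult_mat_vec)
  have root_part: "(?F1 *\<^sub>v ?v) $ x =
      1 / 2 * ((\<Sum>k\<in>shifts m n j l. E (j - k) (l + k)) - (\<Sum>k\<in>shifts m n l j. E (j + k) (l - k)))"
  proof -
    have "(?F1 *\<^sub>v ?v) $ x = (\<Sum>s\<in>cg_pairs (n - m) n. (M1 s *\<^sub>v ?v) $ x)"
      by (intro index_finsum_mult_mat_vec finite_cg_pairs M v assms(7))
    also have "\<dots> = (\<Sum>s\<in>cg_pairs (n - m) n. 1 / 2 *
        ((case s of (a, b, c, d) \<Rightarrow> if b = j \<and> c = l then E a d else 0) -
         (case s of (a, b, c, d) \<Rightarrow> if b = l \<and> c = j then E d a else 0)))"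
    proof (rule sum.cong)
      fix s assume "s \<in> cg_pairs (n - m) n"
      then obtain a b c d where s: "s = (a, b, c, d)" and range: "{a, b, d, c, j, l} \<subseteq> {1..int n}"
        using assms(5,6) by (cases s) (auto simp: cg_pairs_def)
      have "(M1 s *\<^sub>v ?v) $ x =
          1 / 2 * ((if b = j \<and> c = l then E a d else 0) - (if c = j \<and> b = l then E d a else 0))"
        unfolding s M1_def prod.case E_def by (rule wedge_mult_basis[OF range assms(7)])
      then show "(M1 s *\<^sub>v ?v) $ x = 1 / 2 *
        ((case s of (a, b, c, d) \<Rightarrow> if b = j \<and> c = l then E a d else 0) -
         (case s of (a, b, c, d) \<Rightarrow> if b = l \<and> c = j then E d a else 0))"
        by (simp only: s prod.case conj_commute)
    qed simp
    also have "\<dots> = 1 / 2 * ((\<Sum>k\<in>shifts m n j l. E (j - k) (l + k)) -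
        (\<Sum>k\<in>shifts m n l j. E (j + k) (l - k)))"
      unfolding sum_wedge_components
      using sum_cg_pairs[OF assms(2,3), of j l E] sum_cg_pairs[OF assms(2,3), of l j "\<lambda>a d. E d a"]
      by simp
    finally show ?thesis .
  qed
  have "(?F2 *\<^sub>v ?v) $ x = 1 / 2 * ((if j < l then c j l * E j l else 0) -
      (if l < j then c l j * E j l else 0))"
  proof -
    have "(?F2 *\<^sub>v ?v) $ x = (\<Sum>s\<in>index_pairs n. (M2 s *\<^sub>v ?v) $ x)"
      by (intro index_finsum_mult_mat_vec finite_index_pairs M v assms(7))
    also have "\<dots> = (\<Sum>s\<in>index_pairs n. 1 / 2 *
        ((case s of (a, b) \<Rightarrow> if a = j \<and> b = l then c a b * E a b else 0) -
         (case s of (a, b) \<Rightarrow> if a = l \<and> b = j then c a b * E b a else 0)))"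
    proof (rule sum.cong)
      fix s assume "s \<in> index_pairs n"
      then obtain a b where s: "s = (a, b)" and range: "{a, a, b, b, j, l} \<subseteq> {1..int n}"
        using assms(5,6) by (cases s) (auto simp: index_pairs_def)
      have "(M2 s *\<^sub>v ?v) $ x = c a b * ((elem_mat n a a \<and>\<^sub>m elem_mat n b b :: 'a mat) *\<^sub>v ?v) $ x"
        unfolding s M2_def prod.case by (rule index_smult_mat_mult_vec[OF W v assms(7)])
      also have "((elem_mat n a a \<and>\<^sub>m elem_mat n b b :: 'a mat) *\<^sub>v ?v) $ x =
          1 / 2 * ((if a = j \<and> b = l then E a b else 0) - (if b = j \<and> a = l then E b a else 0))"
        unfolding E_def by (rule wedge_mult_basis[OF range assms(7)])
      finally have action: "(M2 s *\<^sub>v ?v) $ x = c a b *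
          (1 / 2 * ((if a = j \<and> b = l then E a b else 0) - (if b = j \<and> a = l then E b a else 0)))" .
      show "(M2 s *\<^sub>v ?v) $ x = 1 / 2 *
        ((case s of (a, b) \<Rightarrow> if a = j \<and> b = l then c a b * E a b else 0) -
         (case s of (a, b) \<Rightarrow> if a = l \<and> b = j then c a b * E b a else 0))"
        unfolding action by (simp only: s prod.case mult_half_if_diff conj_commute)
    qed simp
    also have "\<dots> = 1 / 2 * ((if j < l then c j l * E j l else 0) -
      (if l < j then c l j * E j l else 0))"
      unfolding sum_wedge_components
      using sum_index_pairs[OF assms(5,6), of "\<lambda>a b. c a b * E a b"]
        sum_index_pairs[OF assms(6,5), of "\<lambda>a b. c a b * E b a"]
      by simp
    finally show ?thesis .
  qed
  also have "\<dots> = (1 / 2 * of_int (sgn (cg_psi m n j - cg_psi m n l))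
        - 1 / of_nat n * of_int (cg_psi m n j - cg_psi m n l)) * E j l" (is "?lhs = ?R * E j l")
  proof -
    consider "j < l" | "l < j" | "j = l" by linarith
    then show ?thesis
    proof cases
      case 1
      then have "?lhs = (1 / 2 * c j l) * E j l" by simp
      also have "1 / 2 * c j l = ?R"
        unfolding c_def using 1 by (intro cartan_coefficient assms(2-6)) simp
      finally show ?thesis .
    next
      case 2
      then have "?lhs = - (1 / 2 * c l j) * E j l" by simp
      also have "1 / 2 * c l j = 1 / 2 * of_int (sgn (cg_psi m n l - cg_psi m n j))
        - 1 / of_nat n * of_int (cg_psi m n l - cg_psi m n j)"
        unfolding c_def using 2 by (intro cartan_coefficient assms(2-6)) simp
      also have "sgn (cg_psi m n l - cg_psi m n j) = - sgn (cg_psi m n j - cg_psi m n l)"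
        by (simp add: sgn_if)
      finally show ?thesis by (simp add: diff_divide_distrib)
    qed simp
  qed
  finally have cartan_part: "(?F2 *\<^sub>v ?v) $ x = (1 / 2 * of_int (sgn (cg_psi m n j - cg_psi m n l))
        - 1 / of_nat n * of_int (cg_psi m n j - cg_psi m n l)) * E j l" .
  have permutation_part: "(?F3 *\<^sub>v ?v) $ x = 1 / 2 * of_int (sgn (j - l)) * E l j"
  proof -
    have "(?F3 *\<^sub>v ?v) $ x = (\<Sum>s\<in>index_pairs n. (M3 s *\<^sub>v ?v) $ x)"
      by (intro index_finsum_mult_mat_vec finite_index_pairs M v assms(7))
    also have "\<dots> = (\<Sum>s\<in>index_pairs n. 1 / 2 *
        ((case s of (a, b) \<Rightarrow> if a = l \<and> b = j then E a b else 0) -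
         (case s of (a, b) \<Rightarrow> if a = j \<and> b = l then E b a else 0)))"
    proof (rule sum.cong)
      fix s assume "s \<in> index_pairs n"
      then obtain a b where s: "s = (a, b)" and range: "{a, b, b, a, j, l} \<subseteq> {1..int n}"
        using assms(5,6) by (cases s) (auto simp: index_pairs_def)
      have "(M3 s *\<^sub>v ?v) $ x =
          1 / 2 * ((if b = j \<and> a = l then E a b else 0) - (if a = j \<and> b = l then E b a else 0))"
        unfolding s M3_def prod.case E_def by (rule wedge_mult_basis[OF range assms(7)])
      then show "(M3 s *\<^sub>v ?v) $ x = 1 / 2 *
        ((case s of (a, b) \<Rightarrow> if a = l \<and> b = j then E a b else 0) -
         (case s of (a, b) \<Rightarrow> if a = j \<and> b = l then E b a else 0))"
        by (simp only: s prod.case conj_commute)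
    qed simp
    also have "\<dots> = 1 / 2 * of_int (sgn (j - l)) * E l j"
      unfolding sum_wedge_components
      using sum_index_pairs[OF assms(5,6), of "\<lambda>a b. E b a"] sum_index_pairs[OF assms(6,5), of E]
      by (simp add: sgn_if)
    finally show ?thesis .
  qed
  show ?thesis unfolding split root_part cartan_part permutation_part by simp
qed

theorem theorem2p3:
  fixes m n :: nat and j l :: int
  assumes "0 < m" and "m < n" and "coprime m n"
    and "j \<in> {1..int n}" and "l \<in> {1..int n}"
  shows "(cg_r (n - m) n :: 'a::{alg_closed_field, field_char_0} mat)
      *\<^sub>v (basis_vec n j \<otimes>\<^sub>v basis_vec n l) =
    (\<Oplus>\<^bsub>tensor_vecs n\<^esub>t\<in>{0..<cg_L m n}.
      \<Oplus>\<^bsub>tensor_vecs n\<^esub>N\<in>{0..(cg_J m n t j l - 1) div cg_i m n (t + 1)}.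
        basis_vec n (j - cg_J m n t j l + N * cg_i m n (t + 1)) \<otimes>\<^sub>v
        basis_vec n (l + cg_J m n t j l - N * cg_i m n (t + 1)))
    - (\<Oplus>\<^bsub>tensor_vecs n\<^esub>t\<in>{0..<cg_L m n}.
      \<Oplus>\<^bsub>tensor_vecs n\<^esub>N\<in>{0..(cg_J m n t l j - 1) div cg_i m n (t + 1)}.
        basis_vec n (j + cg_J m n t l j - N * cg_i m n (t + 1)) \<otimes>\<^sub>v
        basis_vec n (l - cg_J m n t l j + N * cg_i m n (t + 1)))
    + (1 / 2 * of_int (sgn (cg_psi m n j - cg_psi m n l))
        - 1 / of_nat n * of_int (cg_psi m n j - cg_psi m n l))
      \<cdot>\<^sub>v (basis_vec n j \<otimes>\<^sub>v basis_vec n l)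
    - (1 / 2 * of_int (sgn (j - l))) \<cdot>\<^sub>v (basis_vec n l \<otimes>\<^sub>v basis_vec n j)"
    (is "?r *\<^sub>v ?v = ?S1 - ?S2 + ?c \<cdot>\<^sub>v ?v - ?d \<cdot>\<^sub>v ?w")
proof (rule eq_vecI)
  have T: "(basis_vec n a \<otimes>\<^sub>v basis_vec n b :: 'a vec) \<in> carrier_vec (n * n)" for a b
    by (intro kron_vec_carrier basis_vec_carrier)
  then have dims: "?S1 \<in> carrier_vec (n * n)" "?S2 \<in> carrier_vec (n * n)"
    "?v \<in> carrier_vec (n * n)" "?w \<in> carrier_vec (n * n)"
    by (auto intro!: finsum_module_vec_closed)
  have "?r \<in> carrier_mat (n * n) (n * n)"
    unfolding cg_r_def
    by (intro add_carrier_mat finsum_module_mat_closed) (auto intro!: wedge_mat_carrier elem_mat_carrier)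
  then show "dim_vec (?r *\<^sub>v ?v) = dim_vec (?S1 - ?S2 + ?c \<cdot>\<^sub>v ?v - ?d \<cdot>\<^sub>v ?w)"
    using dims by simp
  fix x assume "x < dim_vec (?S1 - ?S2 + ?c \<cdot>\<^sub>v ?v - ?d \<cdot>\<^sub>v ?w)"
  then have x: "x < n * n" using dims by simp
  define E where "E = (\<lambda>a b. (basis_vec n a \<otimes>\<^sub>v basis_vec n b :: 'a vec) $ x)"
  have S1: "?S1 $ x = (\<Sum>k\<in>shifts m n j l. E (j - k) (l + k)) + (if l < j then E l j else 0)"
  proof -
    have "?S1 $ x = (\<Sum>t\<in>{0..<cg_L m n}. \<Sum>N\<in>{0..(cg_J m n t j l - 1) div cg_i m n (t + 1)}.
        E (j - cg_J m n t j l + N * cg_i m n (t + 1)) (l + cg_J m n t j l - N * cg_i m n (t + 1)))"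
      unfolding E_def by (rule index_finsum_finsum_module_vec) (use x T in auto)
    then show ?thesis
      using sum_shifts[OF assms, of "\<lambda>k. E (j - k) (l + k)"] by (auto simp: algebra_simps)
  qed
  have S2: "?S2 $ x = (\<Sum>k\<in>shifts m n l j. E (j + k) (l - k)) + (if j < l then E l j else 0)"
  proof -
    have "?S2 $ x = (\<Sum>t\<in>{0..<cg_L m n}. \<Sum>N\<in>{0..(cg_J m n t l j - 1) div cg_i m n (t + 1)}.
        E (j + cg_J m n t l j - N * cg_i m n (t + 1)) (l - cg_J m n t l j + N * cg_i m n (t + 1)))"
      unfolding E_def by (rule index_finsum_finsum_module_vec) (use x T in auto)
    then show ?thesis
      using sum_shifts[OF assms(1-3) assms(5,4), of "\<lambda>k. E (j + k) (l - k)"] by (auto simp: algebra_simps)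
  qed
  have "(?S1 - ?S2 + ?c \<cdot>\<^sub>v ?v - ?d \<cdot>\<^sub>v ?w) $ x = ?S1 $ x - ?S2 $ x + ?c * E j l - ?d * E l j"
    using x dims by (simp add: E_def)
  also have "\<dots> = (\<Sum>k\<in>shifts m n j l. E (j - k) (l + k)) - (\<Sum>k\<in>shifts m n l j. E (j + k) (l - k))
      + ?c * E j l + ?d * E l j"
    unfolding S1 S2 by (auto simp: sgn_if algebra_simps)
  also have "\<dots> = (?r *\<^sub>v ?v) $ x"
    unfolding E_def by (rule cg_r_action[OF assms x, symmetric])
  finally show "(?r *\<^sub>v ?v) $ x = (?S1 - ?S2 + ?c \<cdot>\<^sub>v ?v - ?d \<cdot>\<^sub>v ?w) $ x" by simp
qed

end
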